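(* Let $f$ be analytically extendable into $\boldsymbol\Sigma(\boldsymbol\tau)$ for an isotone sequence $\boldsymbol\tau=\{\tau_n\}_{n\ge 1}$ with $\tau_n\to\infty$, and assume $\tau_n\ge c\,n^{r}$ for all $n\ge 1$ with some $r>1$ and some constant $c>0$. Let $\kappa_n=\tau_n+\sqrt{1+\tau_n^2}$, let the weights be $w_n=\log(\kappa_n)$, and let the numbers of points of the univariate Gauss-Legendre quadratures be $N_j=\lceil \tfrac12(j+2)\rceil$. Then, for every $\beta$ with $1<\beta<r$, there exists a constant $c(\mathbf w,\beta)$, independent of the dimension $m$ and of the level $q$, such that the error of the anisotropic sparse grid quadrature is bounded in terms of its number of quadrature points $N(q)$ by \[ \big|\big(\mathbf I-\mathcal A_{\mathbf w}(q,m)\big)f_m\big|\le c(\mathbf w,\beta)\,N(q)^{-(\beta-1)/2}\,\|f_m\|_{C(\boldsymbol\Sigma_m)} . \]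
   Context: Here $\mathbb N=\{0,1,2,\ldots\}$, $\mathbb N^*=\{1,2,\ldots\}$, $\Gamma=[-1,1]$, and $m\in\mathbb N^*$ is the dimension. Analyticity. For $\tau>0$ let $\Sigma(\Gamma,\tau)=\{z\in\mathbb C:\operatorname{dist}(z,\Gamma)\le\tau\}$. Given $\boldsymbol\tau=\{\tau_n\}_{n\ge1}$, put $\Sigma_n=\Sigma(\Gamma,\tau_n)$, $\boldsymbol\Sigma(\boldsymbol\tau)=\prod_{n=1}^\infty\Sigma_n$ and $\boldsymbol\Sigma_m=\prod_{n=1}^m\Sigma_n$. The integrand $f:\Gamma^\infty\to\mathbb R$ is integrable with respect to the product of the normalized Lebesgue measures $dy/2$ on $\Gamma$. Given a fixed anchor point $\overline{\boldsymbol\psi}\in\Gamma^\infty$, let $f_m(y_1,\ldots,y_m)=f(y_1,\ldots,y_m,\overline\psi_{m+1},\overline\psi_{m+2},\ldots)$. If $f$ is analytically extendable into $\boldsymbol\Sigma(\boldsymbol\tau)$, then $f_m$ is analytically extendable into $\boldsymbol\Sigma_m$; the extension is also denoted $f_m$, and $\|f_m\|_{C(\boldsymbol\Sigma_m)}=\sup_{\mathbf z\in\boldsymbol\Sigma_m}|f_m(\mathbf z)|$. Integral. $\mathbf I f_m=\int_{\Gamma^m}f_m(\mathbf y)\,2^{-m}\,d\mathbf y$. Quadrature. For $j\in\mathbb N$, $\operatorname Q_j$ denotes the $N_j$-point Gauss-Legendre quadrature on $\Gamma$ for the measure $dy/2$ (weights summing to $1$), with point set $\theta_j\subset\Gamma$.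 Put $\operatorname Q_{-1}=0$ and $\Delta_j=\operatorname Q_j-\operatorname Q_{j-1}$. A superscript $(n)$ indicates that an operator acts on the $n$-th variable. For the weight vector $\mathbf w=(w_1,\ldots,w_m)$ with positive, ascendingly ordered entries and a level $q\in\mathbb N$, let \[ X_{\mathbf w}(q,m)=\Big\{\boldsymbol\alpha\in\mathbb N^m:\sum_{n=1}^m\alpha_nw_n\le q\Big\},\qquad Y_{\mathbf w}(q,m)=\Big\{\boldsymbol\alpha\in\mathbb N^m:q-\sum_{n=1}^m w_n<\sum_{n=1}^m\alpha_nw_n\le q\Big\}. \] The anisotropic sparse grid quadrature of level $q$ is \[ \mathcal A_{\mathbf w}(q,m)=\sum_{\boldsymbol\alpha\in X_{\mathbf w}(q,m)}\Delta^{(1)}_{\alpha_1}\otimes\cdots\otimes\Delta^{(m)}_{\alpha_m}, \] equivalently, by the combination technique, $\mathcal A_{\mathbf w}(q,m)=\sum_{\boldsymbol\alpha\in Y_{\mathbf w}(q,m)}c_{\mathbf w}(\boldsymbol\alpha)\,\operatorname Q^{(1)}_{\alpha_1}\otimes\cdots\otimes\operatorname Q^{(m)}_{\alpha_m}$ with $c_{\mathbf w}(\boldsymbol\alpha)=\sum_{\boldsymbol\beta\in\{0,1\}^m,\ \boldsymbol\alpha+\boldsymbol\beta\in Y_{\mathbf w}(q,m)}(-1)^{\|\boldsymbol\beta\|_1}$. Cost. $N(q)=\operatorname{cost}(\mathcal A_{\mathbf w}(q,m))$ is the number of quadrature points used in the combination technique formula, i.e. the number of points of the anisotropic sparse grid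 $\bigcup_{\boldsymbol\alpha\in Y_{\mathbf w}(q,m)}\theta_{\alpha_1}\times\cdots\times\theta_{\alpha_m}$. *)

theory Defs
  imports "HOL-Probability.Probability" "HOL-Computational_Algebra.Polynomial"
begin

text \<open>
  Coordinates are numbered from 1, as in \<open>y\<^sub>1, y\<^sub>2, \<dots>\<close>.  A point with coordinates in an index set
  \<open>I\<close> is an extensional function on \<open>I\<close>, so that \<open>\<Gamma>\<^sup>m\<close> is \<open>{1..m} \<rightarrow>\<^sub>E \<Gamma>\<close> and the infinite product is
  \<open>{1..} \<rightarrow>\<^sub>E \<Gamma>\<close>.
\<close>

abbreviation \<Gamma> :: "real set" where
  "\<Gamma> \<equiv> {-1..1}"

text \<open>The normalized Lebesgue measure \<open>dy/2\<close>, with underlying space \<open>\<Gamma>\<close>.\<close>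

definition \<Gamma>_measure :: "real measure" where
  "\<Gamma>_measure = scale_measure (1/2) (restrict_space lborel \<Gamma>)"


subsection \<open>Analyticity\<close>

definition \<Sigma>_nbhd :: "real \<Rightarrow> complex set" where
  "\<Sigma>_nbhd t = {z. infdist z (complex_of_real ` \<Gamma>) \<le> t}"

text \<open>
  Joint analyticity of a function of the finitely many complex variables indexed by \<open>J\<close>: near every
  point of \<open>S\<close> the function is the sum of its power series, indexed by the multi-indices on \<open>J\<close>.
  As for \<^const>\<open>analytic_on\<close>, \<open>S\<close> need not be open.
\<close>

definition multi_analytic_on ::
    "nat set \<Rightarrow> ((nat \<Rightarrow> complex) \<Rightarrow> complex) \<Rightarrow> (nat \<Rightarrow> complex) set \<Rightarrow> bool" where
  "multi_analytic_on J g S \<longleftrightarrow>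
     (\<forall>z\<in>S. \<exists>\<rho>>0. \<exists>a :: (nat \<Rightarrow> nat) \<Rightarrow> complex. \<forall>h \<in> J \<rightarrow>\<^sub>E ball 0 \<rho>.
        ((\<lambda>\<alpha>. a \<alpha> * (\<Prod>j\<in>J. h j ^ \<alpha> j)) has_sum g (\<lambda>j\<in>J. z j + h j)) (J \<rightarrow>\<^sub>E UNIV))"

text \<open>
  \<open>F\<close> is an analytic extension of \<open>f\<close> into the infinite product of the sets \<open>\<Sigma>_nbhd (\<tau> n)\<close>.  Analyticity
  in infinitely many variables is joint analyticity in every finite set \<open>J\<close> of variables, the
  remaining variables being frozen at arbitrary values in the product.
\<close>

definition analytic_extension ::
    "(nat \<Rightarrow> real) \<Rightarrow> ((nat \<Rightarrow> real) \<Rightarrow> real) \<Rightarrow> ((nat \<Rightarrow> complex) \<Rightarrow> complex) \<Rightarrow> bool" where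
  "analytic_extension \<tau> f F \<longleftrightarrow>
     (\<forall>y \<in> {1..} \<rightarrow>\<^sub>E \<Gamma>. F (\<lambda>n\<in>{1..}. complex_of_real (y n)) = complex_of_real (f y)) \<and>
     (\<forall>J. finite J \<and> J \<subseteq> {1..} \<longrightarrow>
        (\<forall>z \<in> Pi\<^sub>E {1..} (\<lambda>n. \<Sigma>_nbhd (\<tau> n)).
           multi_analytic_on J (\<lambda>x. F (merge J ({1..} - J) (x, z))) (Pi\<^sub>E J (\<lambda>n. \<Sigma>_nbhd (\<tau> n)))))"


subsection \<open>Anchored truncation, integral and norm\<close>

text \<open>
  The function \<open>f\<^sub>m\<close>; it is used both for the integrand (real arguments) and for its extension
  (complex arguments).
\<close>

definition anchored :: "(nat \<Rightarrow> 'a) \<Rightarrow> nat \<Rightarrow> ((nat \<Rightarrow> 'a) \<Rightarrow> 'b) \<Rightarrow> (nat \<Rightarrow> 'a) \<Rightarrow> 'b" where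
  "anchored \<psi> m f = (\<lambda>y. f (merge {1..m} {m<..} (y, \<psi>)))"

definition integral_op :: "nat \<Rightarrow> ((nat \<Rightarrow> real) \<Rightarrow> real) \<Rightarrow> real" where
  "integral_op m g = (LINT y | Pi\<^sub>M {1..m} (\<lambda>_. \<Gamma>_measure). g y)"

definition \<Sigma>_norm :: "(nat \<Rightarrow> real) \<Rightarrow> nat \<Rightarrow> ((nat \<Rightarrow> complex) \<Rightarrow> complex) \<Rightarrow> real" where
  "\<Sigma>_norm \<tau> m g = (SUP z \<in> Pi\<^sub>E {1..m} (\<lambda>n. \<Sigma>_nbhd (\<tau> n)). cmod (g z))"


subsection \<open>Gauss-Legendre quadrature\<close>

text \<open>Rodrigues' formula.\<close>

definition legendre :: "nat \<Rightarrow> real poly" where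
  "legendre n = smult (1 / (2 ^ n * fact n)) ((pderiv ^^ n) ([:-1, 0, 1:] ^ n))"

definition gauss_points :: "nat \<Rightarrow> real set" where
  "gauss_points n = {x. poly (legendre n) x = 0}"

text \<open>The weight of a node is the integral of its Lagrange basis polynomial.\<close>

definition gauss_weight :: "nat \<Rightarrow> real \<Rightarrow> real" where
  "gauss_weight n x =
     (LINT t | \<Gamma>_measure. (\<Prod>y \<in> gauss_points n - {x}. (t - y) / (x - y)))"

definition gauss_quad :: "nat \<Rightarrow> (real \<Rightarrow> real) \<Rightarrow> real" where
  "gauss_quad n v = (\<Sum>x \<in> gauss_points n. gauss_weight n x * v x)"


subsection \<open>Anisotropic sparse grid quadrature\<close>

text \<open>In the following, \<open>N j\<close> is the number of points of the univariate quadrature of level \<open>j\<close>.\<close>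

definition quad_diff :: "(nat \<Rightarrow> nat) \<Rightarrow> nat \<Rightarrow> (real \<Rightarrow> real) \<Rightarrow> real" where
  "quad_diff N j v = gauss_quad (N j) v - (if j = 0 then 0 else gauss_quad (N (j - 1)) v)"

text \<open>
  \<open>tensor_op L m\<close> is the tensor product of \<open>L 1, \<dots>, L m\<close>, with \<open>L n\<close> acting on the \<open>n\<close>-th variable.
  After all the updates the function is evaluated at points that are \<^const>\<open>undefined\<close> outside \<open>{1..m}\<close>,
  i.e. at extensional ones.
\<close>

primrec tensor_op ::
    "(nat \<Rightarrow> (real \<Rightarrow> real) \<Rightarrow> real) \<Rightarrow> nat \<Rightarrow> ((nat \<Rightarrow> real) \<Rightarrow> real) \<Rightarrow> real" where
  "tensor_op L 0 g = g (\<lambda>_. undefined)"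
| "tensor_op L (Suc m) g = tensor_op L m (\<lambda>y. L (Suc m) (\<lambda>t. g (y(Suc m := t))))"

definition X_set :: "(nat \<Rightarrow> real) \<Rightarrow> nat \<Rightarrow> nat \<Rightarrow> (nat \<Rightarrow> nat) set" where
  "X_set w q m = {\<alpha> \<in> {1..m} \<rightarrow>\<^sub>E UNIV. (\<Sum>n=1..m. real (\<alpha> n) * w n) \<le> real q}"

definition Y_set :: "(nat \<Rightarrow> real) \<Rightarrow> nat \<Rightarrow> nat \<Rightarrow> (nat \<Rightarrow> nat) set" where
  "Y_set w q m = {\<alpha> \<in> {1..m} \<rightarrow>\<^sub>E UNIV.
     real q - (\<Sum>n=1..m. w n) < (\<Sum>n=1..m. real (\<alpha> n) * w n) \<and>
     (\<Sum>n=1..m. real (\<alpha> n) * w n) \<le> real q}"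

definition sparse_quad ::
    "(nat \<Rightarrow> real) \<Rightarrow> (nat \<Rightarrow> nat) \<Rightarrow> nat \<Rightarrow> nat \<Rightarrow> ((nat \<Rightarrow> real) \<Rightarrow> real) \<Rightarrow> real" where
  "sparse_quad w N q m g = (\<Sum>\<alpha> \<in> X_set w q m. tensor_op (\<lambda>n. quad_diff N (\<alpha> n)) m g)"

definition sparse_grid ::
    "(nat \<Rightarrow> real) \<Rightarrow> (nat \<Rightarrow> nat) \<Rightarrow> nat \<Rightarrow> nat \<Rightarrow> (nat \<Rightarrow> real) set" where
  "sparse_grid w N q m = (\<Union>\<alpha> \<in> Y_set w q m. Pi\<^sub>E {1..m} (\<lambda>n. gauss_points (N (\<alpha> n))))"

definition cost :: "(nat \<Rightarrow> real) \<Rightarrow> (nat \<Rightarrow> nat) \<Rightarrow> nat \<Rightarrow> nat \<Rightarrow> nat" where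
  "cost w N q m = card (sparse_grid w N q m)"

end

theory Submission
  imports Defs "HOL-Complex_Analysis.Cauchy_Integral_Formula"
begin

text \<open>
  The quadratures of level \<open>j\<close> and \<open>j - 1\<close> are both exact on polynomials of degree \<open>j\<close>, so Chebyshev
  approximation on the Bernstein ellipse with sum of semi-axes \<open>\<kappa> n\<close>, which lies in
  \<open>\<Sigma>_nbhd (\<tau> n)\<close>, bounds the level-\<open>j\<close> difference in the \<open>n\<close>-th variable by a constant times
  \<open>\<kappa> n ^ (- j)\<close>. The full tensor product of the level-\<open>K\<close> quadratures is the sum of the tensor
  products of differences over a box of multi-indices and tends to the integral as \<open>K\<close> grows; hence
  the error of the sparse grid quadrature is at most the sum of the bounds of the multi-indices outside
  \<open>X_set w q m\<close>. There the product of the \<open>\<kappa> n ^ \<alpha> n\<close> exceeds \<open>exp q\<close>, and splitting off its power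
  with exponent \<open>1 - 1 / \<beta>\<close> yields \<open>exp (- (1 - 1 / \<beta>) q)\<close> times an infinite product that converges
  because \<open>\<kappa> n powr (- 1 / \<beta>)\<close> is summable. The same device bounds the number of grid points by a
  constant times \<open>exp (q / \<beta>)\<close>.
\<close>

subsection \<open>The normalized Lebesgue measure\<close>

text \<open>Independence of the dimension shapes every estimate. A constant factor per variable
  would enter with the power \<open>m\<close>; hence the level-0 functional is bounded by exactly 1,
  and the positive levels of the \<open>n\<close>-th variable must sum to a multiple of
  \<open>\<kappa> n powr (- 1 / \<beta>)\<close>. Then \<open>1 + t \<le> exp t\<close> turns the
  product over the variables into the exponential of a convergent series. Isotony gives
  \<open>\<kappa> n \<ge> \<kappa> 1\<close>, so the univariate constants can be taken uniform in
  \<open>n\<close>; convergence comes from \<open>\<kappa> n \<ge> c * n powr r\<close> and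
  \<open>\<beta> < r\<close>. Error and cost use the same summable weight, which leaves
  \<open>exp (- (1 - 1 / \<beta>) q)\<close> for the error and \<open>exp (q / \<beta>)\<close> for
  the cost. Eliminating \<open>q\<close> compares the exponents \<open>1 - 1 / \<beta>\<close> and
  \<open>1 / \<beta>\<close>, whose ratio is \<open>\<beta> - 1\<close>; half of this ratio is the
  exponent of the claim. A second obstacle is that a functional in one variable meets slices of the
  extension whose other variables are complex. Real functionals are therefore made to act on
  complex-valued functions.\<close>

lemma space_Gamma_measure [simp]: "space \<Gamma>_measure = \<Gamma>"
  by (simp add: \<Gamma>_measure_def space_scale_measure space_restrict_space)

text \<open>As a density, the measure comes within reach of \<open>integral_density\<close> and
  \<open>emeasure_density_const\<close>.\<close>

lemma Gamma_measure_eq_density: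
  "\<Gamma>_measure = density (restrict_space lborel \<Gamma>) (\<lambda>_. ennreal (1/2))"
  unfolding \<Gamma>_measure_def
proof (rule measure_eqI)
  fix A assume "A \<in> sets (scale_measure (1/2) (restrict_space lborel \<Gamma>))"
  \<comment> \<open>The factor in the definition is a quotient of extended nonnegative reals, while
    the density is the image of a real quotient.\<close>
  moreover have "(1/2::ennreal) = ennreal (1/2)"
    by (metis divide_ennreal ennreal_1 ennreal_numeral zero_le_one zero_less_numeral zero_le_numeral)
  ultimately show "emeasure (scale_measure (1/2) (restrict_space lborel \<Gamma>)) A =
      emeasure (density (restrict_space lborel \<Gamma>) (\<lambda>_. ennreal (1/2))) A"
    by (simp add: emeasure_density_const)
qed simp

lemma sets_Gamma_measure: "sets \<Gamma>_measure = sets (restrict_space borel \<Gamma>)"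
  by (simp add: \<Gamma>_measure_def cong: sets_restrict_space_cong)

lemma prob_space_Gamma_measure: "prob_space \<Gamma>_measure"
proof
  have "emeasure \<Gamma>_measure \<Gamma> = ennreal (1/2) * emeasure (restrict_space lborel \<Gamma>) \<Gamma>"
    unfolding Gamma_measure_eq_density
    by (rule emeasure_density_const) (auto simp: sets_restrict_space)
  also have "emeasure (restrict_space lborel \<Gamma>) \<Gamma> = ennreal 2"
    by (subst emeasure_restrict_space) auto
  also have "ennreal (1/2) * ennreal 2 = 1"
    by (subst ennreal_mult[symmetric]) auto
  finally show "emeasure \<Gamma>_measure (space \<Gamma>_measure) = 1" by simp
qed

interpretation Gamma_measure: prob_space \<Gamma>_measure
  by (rule prob_space_Gamma_measure)

lemma borel_measurable_Gamma_continuous: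
  fixes f :: "real \<Rightarrow> 'b::topological_space"
  assumes "continuous_on \<Gamma> f"
  shows "f \<in> borel_measurable \<Gamma>_measure"
  using borel_measurable_continuous_on_restrict[OF assms]
  by (simp add: measurable_cong_sets[OF sets_Gamma_measure refl])

lemma integrable_Gamma_continuous:
  fixes f :: "real \<Rightarrow> real"
  assumes "continuous_on \<Gamma> f"
  shows "integrable \<Gamma>_measure f"
proof -
  have "bounded (f ` \<Gamma>)"
    by (intro compact_imp_bounded compact_continuous_image assms) auto
  then obtain B where B: "\<And>x. x \<in> \<Gamma> \<Longrightarrow> norm (f x) \<le> B"
    by (meson bounded_iff imageI)
  show ?thesis
    by (rule Gamma_measure.integrable_const_bound[where B = B])
       (use B in \<open>auto intro!: AE_I2 borel_measurable_Gamma_continuous assms\<close>)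
qed

lemma integral_Gamma_FTC:
  fixes f F :: "real \<Rightarrow> real"
  assumes F: "\<And>x. DERIV F x :> f x" and f: "\<And>x. isCont f x"
  shows "(LINT t | \<Gamma>_measure. f t) = (F 1 - F (-1)) / 2"
proof -
  have cont: "continuous_on A f" for A
    using f by (simp add: continuous_at_imp_continuous_on)
  have "(LINT t | \<Gamma>_measure. f t) = (LINT t | restrict_space lborel \<Gamma>. (1/2) *\<^sub>R f t)"
    unfolding Gamma_measure_eq_density
    by (rule integral_density)
       (use borel_measurable_continuous_on_restrict[OF cont] in
         \<open>auto simp: measurable_cong_sets[OF sets_restrict_space_cong[OF sets_lborel] refl]\<close>)
  also have "\<dots> = 1/2 * (LINT t | restrict_space lborel \<Gamma>. f t)"
    by simp
  also have "(LINT t | restrict_space lborel \<Gamma>. f t) = (LINT x|lborel. indicator \<Gamma> x *\<^sub>R f x)"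
    by (rule integral_restrict_space) auto
  also have "\<dots> = (LINT x|lborel. f x * indicator \<Gamma> x)"
    by (simp add: mult.commute)
  also have "\<dots> = F 1 - F (-1)"
    by (rule integral_FTC_Icc_real) (use F f in auto)
  finally show ?thesis by simp
qed

lemma integral_Gamma_pderiv:
  "(LINT t | \<Gamma>_measure. poly (pderiv p) t) = (poly p 1 - poly p (-1)) / 2"
  by (rule integral_Gamma_FTC) auto

lemma integrable_Gamma_poly [simp]: "integrable \<Gamma>_measure (poly p)"
  by (intro integrable_Gamma_continuous continuous_intros)

subsection \<open>Gauss-Legendre quadrature\<close>

lemma power_dvd_pderiv:
  fixes c p :: "'a::idom poly"
  assumes "c ^ Suc k dvd p"
  shows "c ^ k dvd pderiv p"
proof -
  obtain r where "p = c ^ Suc k * r" using assms by (auto elim: dvdE)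
  then have "pderiv p = c ^ k * (smult (of_nat (Suc k)) (pderiv c * r) + c * pderiv r)"
    by (simp add: pderiv_mult pderiv_power_Suc algebra_simps del: power_Suc)
       (simp add: algebra_simps)
  then show ?thesis by simp
qed

lemma power_dvd_pderiv_iterate:
  fixes c :: "'a::idom poly"
  assumes "k \<le> n"
  shows "c ^ (n - k) dvd (pderiv ^^ k) (c ^ n)"
  using assms
proof (induction k)
  case (Suc k)
  then have "c ^ Suc (n - Suc k) dvd (pderiv ^^ k) (c ^ n)"
    by (simp add: Suc_diff_Suc del: power_Suc)
  then show ?case by (simp add: power_dvd_pderiv)
qed simp

text \<open>Up to a scalar \<open>legendre n\<close> is \<open>rodrigues n n\<close>. The number
  \<open>k\<close> of derivatives is kept free because orthogonality and location of zeros are both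
  proved by induction on it.\<close>

abbreviation rodrigues :: "nat \<Rightarrow> nat \<Rightarrow> real poly" where
  "rodrigues n k \<equiv> (pderiv ^^ k) ([:-1, 0, 1:] ^ n)"

text \<open>Each derivative removes at most one factor \<open>x^2 - 1\<close>, so at least one
  survives while \<open>k < n\<close>.\<close>

lemma poly_rodrigues_endpoints:
  assumes "k < n"
  shows "poly (rodrigues n k) 1 = 0" "poly (rodrigues n k) (-1) = 0"
proof -
  have "[:-1, 0, 1:] dvd ([:-1, 0, 1:] ^ (n - k) :: real poly)"
    using assms by (simp add: dvd_power)
  also have "\<dots> dvd rodrigues n k"
    using assms by (intro power_dvd_pderiv_iterate) simp
  finally obtain r where "rodrigues n k = [:-1, 0, 1:] * r" by (auto elim: dvdE)
  then show "poly (rodrigues n k) 1 = 0" "poly (rodrigues n k) (-1) = 0"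
    by simp_all
qed

lemma degree_rodrigues: "degree (rodrigues n k) = 2 * n - k"
  by (induction k) (simp_all add: degree_power_eq degree_pderiv)

text \<open>Integration by parts \<open>k\<close> times: the boundary terms vanish by
  \<open>poly_rodrigues_endpoints\<close>, and each step lowers the degree of \<open>q\<close> by
  one until nothing is left.\<close>

lemma rodrigues_orthogonal:
  assumes "k \<le> n" "degree q < k"
  shows "(LINT t | \<Gamma>_measure. poly (rodrigues n k * q) t) = 0"
  using assms
proof (induction k arbitrary: q)
  case (Suc k)
  have parts: "rodrigues n (Suc k) * q = pderiv (rodrigues n k * q) - rodrigues n k * pderiv q"
    by (simp add: pderiv_mult algebra_simps)
  have "(LINT t | \<Gamma>_measure. poly (pderiv (rodrigues n k * q)) t) = 0"
    unfolding integral_Gamma_pderiv using Suc.prems by (simp add: poly_rodrigues_endpoints)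
  moreover have "(LINT t | \<Gamma>_measure. poly (rodrigues n k * pderiv q) t) = 0"
  \<comment> \<open>The zero polynomial has degree 0, which is not below \<open>k\<close> when
    \<open>k = 0\<close>; this case falls outside the induction hypothesis.\<close>
  proof (cases "pderiv q = 0")
    case False
    then have "degree (pderiv q) < k"
      using Suc.prems by (auto simp: degree_pderiv pderiv_eq_0_iff)
    then show ?thesis using Suc by simp
  qed simp
  ultimately show ?case
    unfolding parts poly_diff
    by (subst Bochner_Integration.integral_diff) (simp_all del: poly_mult)
qed simp

text \<open>Rolle's theorem between neighbouring zeros, organised as removal of the largest zero.
  The strict inclusion between \<open>Min A\<close> and \<open>Max A\<close> keeps the new zeros
  distinct and lets \<open>rodrigues_roots\<close> adjoin both endpoints again.\<close>

lemma card_roots_pderiv: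
  fixes p :: "real poly"
  assumes "finite A" "card A = Suc k" "\<And>x. x \<in> A \<Longrightarrow> poly p x = 0"
  shows "\<exists>B. finite B \<and> card B = k \<and> B \<subseteq> {Min A <..< Max A} \<and> (\<forall>x\<in>B. poly (pderiv p) x = 0)"
  using assms
proof (induction k arbitrary: A)
  case (Suc k)
  define b where "b = Max A"
  define A' where "A' = A - {b}"
  have A: "finite A" "A \<noteq> {}" using Suc.prems by auto
  have b: "b \<in> A" unfolding b_def using A by simp
  have A': "finite A'" "card A' = Suc k"
    using Suc.prems b by (auto simp: A'_def)
  then have "A' \<noteq> {}" by auto
  note A' = A' this
  obtain B where B: "finite B" "card B = k" "B \<subseteq> {Min A' <..< Max A'}"
      "\<forall>x\<in>B. poly (pderiv p) x = 0"
    using Suc.IH[of A'] A' Suc.prems by (auto simp: A'_def)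
  have max: "Max A' \<in> A" "Max A' < b"
    using Max_in[OF A'(1,3)] A by (auto simp: A'_def b_def le_neq_trans)
  have min: "Min A \<le> Min A'"
    using A A' by (intro Min_antimono) (auto simp: A'_def)
  have minmax: "Min A' \<le> Max A'" using A' by simp
  obtain z where z: "Max A' < z" "z < b" "poly (pderiv p) z = 0"
  proof -
    have "\<exists>z. Max A' < z \<and> z < b \<and> DERIV (poly p) z :> 0"
      using max b Suc.prems by (intro Rolle) (auto intro!: continuous_intros)
    then show ?thesis using that DERIV_unique[OF poly_DERIV] by blast
  qed
  show ?case
  proof (intro exI[of _ "insert z B"] conjI)
    show "card (insert z B) = Suc k" using B z by (subst card_insert_disjoint) auto
    show "insert z B \<subseteq> {Min A<..<Max A}"
      using B(3) z min minmax max by (auto simp flip: b_def)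
  qed (use B z in auto)
qed auto

text \<open>While \<open>k < n\<close>, the points -1 and 1 are zeros besides the \<open>k\<close>
  interior ones; Rolle applied to these \<open>k + 2\<close> zeros yields \<open>k + 1\<close>
  interior zeros of the next derivative.\<close>

lemma rodrigues_roots:
  assumes "k \<le> n"
  shows "\<exists>B. finite B \<and> card B = k \<and> B \<subseteq> {-1<..<1} \<and> (\<forall>x\<in>B. poly (rodrigues n k) x = 0)"
  using assms
proof (induction k)
  case (Suc k)
  then obtain B where B: "finite B" "card B = k" "B \<subseteq> {-1<..<1}"
      "\<forall>x\<in>B. poly (rodrigues n k) x = 0" by auto
  define A where "A = insert (-1) (insert 1 B)"
  have "finite A" "card A = Suc (Suc k)"
    using B by (auto simp: A_def card_insert_if)
  moreover have "\<And>x. x \<in> A \<Longrightarrow> poly (rodrigues n k) x = 0"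
    using B Suc.prems by (auto simp: A_def poly_rodrigues_endpoints)
  moreover have "Min A = -1" "Max A = 1"
    unfolding A_def using B(1,3) by (intro Min_eqI Max_eqI; force)+
  ultimately show ?case using card_roots_pderiv[of A "Suc k" "rodrigues n k"] by auto
qed auto

lemma legendre_nonzero: "legendre n \<noteq> 0"
proof (cases "n = 0")
  case False
  then show ?thesis using degree_rodrigues[of n n] by (auto simp: legendre_def)
qed (simp add: legendre_def)

lemma degree_legendre: "degree (legendre n) = n"
  by (simp add: legendre_def degree_rodrigues)

lemma finite_gauss_points [simp]: "finite (gauss_points n)"
  unfolding gauss_points_def by (rule poly_roots_finite[OF legendre_nonzero])

text \<open>Rolle produces \<open>n\<close> zeros inside the interval and the degree allows no
  more.\<close>

lemma gauss_points_eq: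
  "card (gauss_points n) = n" "gauss_points n \<subseteq> \<Gamma>"
proof -
  obtain B where B: "finite B" "card B = n" "B \<subseteq> {-1<..<1}" "\<forall>x\<in>B. poly (rodrigues n n) x = 0"
    using rodrigues_roots[of n n] by auto
  then have sub: "B \<subseteq> gauss_points n" by (auto simp: gauss_points_def legendre_def)
  have le: "card (gauss_points n) \<le> n"
    unfolding gauss_points_def using card_poly_roots_bound[OF legendre_nonzero, of n]
    by (simp add: degree_legendre)
  then have "B = gauss_points n"
    using B sub by (intro card_seteq) auto
  then show "card (gauss_points n) = n" "gauss_points n \<subseteq> \<Gamma>" using B by auto
qed

lemma legendre_orthogonal:
  assumes "degree q < n"
  shows "(LINT t | \<Gamma>_measure. poly (legendre n * q) t) = 0"
  using rodrigues_orthogonal[OF order_refl assms] by (simp add: legendre_def)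

text \<open>The Lagrange basis polynomial as an object of type \<open>poly\<close>, so that its
  degree can be counted.\<close>

definition gauss_basis :: "nat \<Rightarrow> real \<Rightarrow> real poly" where
  "gauss_basis n x = (\<Prod>y \<in> gauss_points n - {x}. [:- y / (x - y), 1 / (x - y):])"

lemma poly_gauss_basis:
  "poly (gauss_basis n x) t = (\<Prod>y \<in> gauss_points n - {x}. (t - y) / (x - y))"
  unfolding gauss_basis_def poly_prod
  by (intro prod.cong) (auto simp: diff_divide_distrib)

lemma gauss_weight_eq: "gauss_weight n x = (LINT t | \<Gamma>_measure. poly (gauss_basis n x) t)"
  by (simp add: gauss_weight_def poly_gauss_basis)

lemma degree_gauss_basis:
  assumes "x \<in> gauss_points n"
  shows "degree (gauss_basis n x) \<le> n - 1"
proof -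
  have "degree (gauss_basis n x)
      \<le> sum (degree \<circ> (\<lambda>y. [:- y / (x - y), 1 / (x - y):])) (gauss_points n - {x})"
    unfolding gauss_basis_def by (rule degree_prod_sum_le) simp
  also have "\<dots> \<le> (\<Sum>y\<in>gauss_points n - {x}. 1)"
    by (intro sum_mono) simp
  finally show ?thesis using assms by (simp add: gauss_points_eq)
qed

lemma gauss_basis_node:
  assumes "x \<in> gauss_points n" "z \<in> gauss_points n"
  shows "poly (gauss_basis n x) z = (if z = x then 1 else 0)"
  using assms by (auto simp: poly_gauss_basis intro!: prod.neutral)

text \<open>The difference of both sides vanishes at \<open>n\<close> nodes but has degree below
  \<open>n\<close>.\<close>

lemma lagrange_interpolation:
  assumes "degree s < n"
  shows "s = (\<Sum>x\<in>gauss_points n. smult (poly s x) (gauss_basis n x))" (is "_ = ?r")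
proof (rule ccontr)
  assume "s \<noteq> ?r"
  then have nz: "s - ?r \<noteq> 0" by simp
  have "degree ?r \<le> n - 1"
    by (intro degree_sum_le finite_gauss_points order.trans[OF degree_smult_le degree_gauss_basis])
  then have "degree (s - ?r) < n"
    using assms degree_diff_le_max[of s ?r] by linarith
  moreover have "gauss_points n \<subseteq> {x. poly (s - ?r) x = 0}"
    by (auto simp: poly_sum gauss_basis_node if_distrib cong: if_cong)
  then have "n \<le> card {x. poly (s - ?r) x = 0}"
    using card_mono[OF poly_roots_finite[OF nz]] gauss_points_eq(1)[of n] by metis
  ultimately show False using card_poly_roots_bound[OF nz] by linarith
qed

text \<open>Division by \<open>legendre n\<close>: the multiple vanishes at the nodes and, its
  cofactor having degree below \<open>n\<close>, also integrates to 0. The remainder is reproduced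
  by interpolation.\<close>

lemma gauss_quad_exact:
  assumes "degree p < 2 * n"
  shows "gauss_quad n (poly p) = (LINT t | \<Gamma>_measure. poly p t)"
proof -
  define q s where "q = p div legendre n" and "s = p mod legendre n"
  have p: "p = legendre n * q + s" by (simp add: q_def s_def)
  have n: "n > 0" using assms by simp
  have s: "degree s < n"
    using degree_mod_less[OF legendre_nonzero, of p n] n by (auto simp: s_def degree_legendre)
  have q: "degree q < n"
  proof (cases "q = 0")
    case False
    then have "n + degree q = degree (legendre n * q)"
      by (simp add: degree_mult_eq legendre_nonzero degree_legendre)
    also have "legendre n * q = p - s" by (simp add: p)
    finally show ?thesis using assms s degree_diff_le_max[of p s] by linarith
  qed (use n in simp)
  have "gauss_quad n (poly p) = (\<Sum>x\<in>gauss_points n. gauss_weight n x * poly s x)"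
    unfolding gauss_quad_def
    by (intro sum.cong) (auto simp: p gauss_points_def)
  also have "\<dots> = (LINT t | \<Gamma>_measure. (\<Sum>x\<in>gauss_points n. poly s x * poly (gauss_basis n x) t))"
    by (simp add: Bochner_Integration.integral_sum gauss_weight_eq mult.commute)
  also have "(\<lambda>t. \<Sum>x\<in>gauss_points n. poly s x * poly (gauss_basis n x) t) = poly s"
  proof (rule sym, rule ext)
    fix t
    have "poly s t = poly (\<Sum>x\<in>gauss_points n. smult (poly s x) (gauss_basis n x)) t"
      using lagrange_interpolation[OF s] by (rule arg_cong)
    then show "poly s t = (\<Sum>x\<in>gauss_points n. poly s x * poly (gauss_basis n x) t)"
      by (simp add: poly_sum)
  qed
  also have "(LINT t | \<Gamma>_measure. poly s t) = (LINT t | \<Gamma>_measure. poly (legendre n * q) t + poly s t)"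
    by (subst Bochner_Integration.integral_add) (simp_all only: legendre_orthogonal[OF q] integrable_Gamma_poly add_0)
  finally have "gauss_quad n (poly p) = (LINT t | \<Gamma>_measure. poly (legendre n * q) t + poly s t)" .
  moreover have "poly p = (\<lambda>t. poly (legendre n * q) t + poly s t)"
    by (simp add: p fun_eq_iff)
  ultimately show ?thesis by metis
qed

text \<open>The square of the basis polynomial has degree at most \<open>2 * n - 2\<close>, so its
  quadrature, which is the weight, equals the integral of a square.\<close>

lemma gauss_weight_nonneg:
  assumes "x \<in> gauss_points n"
  shows "gauss_weight n x \<ge> 0"
proof -
  have n: "n > 0" using assms gauss_points_eq(1)[of n] by (cases n) auto
  let ?b = "gauss_basis n x"
  have "degree (?b * ?b) < 2 * n"
    using degree_mult_le[of ?b ?b] degree_gauss_basis[OF assms] n by linarith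
  then have "gauss_quad n (poly (?b * ?b)) = (LINT t | \<Gamma>_measure. poly (?b * ?b) t)"
    by (rule gauss_quad_exact)
  moreover have "gauss_quad n (poly (?b * ?b)) = gauss_weight n x"
    unfolding gauss_quad_def using assms
    by (simp add: gauss_basis_node if_distrib cong: if_cong sum.cong)
  ultimately show ?thesis by simp
qed

lemma sum_gauss_weight:
  assumes "n > 0"
  shows "(\<Sum>x\<in>gauss_points n. gauss_weight n x) = 1"
  using gauss_quad_exact[of 1 n] assms Gamma_measure.prob_space by (simp add: gauss_quad_def)

subsection \<open>Chebyshev approximation on Bernstein ellipses\<close>

definition joukowski :: "complex \<Rightarrow> complex" where
  "joukowski u = (u + inverse u) / 2"

fun cheb :: "nat \<Rightarrow> complex poly" where
  "cheb 0 = 1"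
| "cheb (Suc 0) = [:0, 1:]"
| "cheb (Suc (Suc n)) = [:0, 2:] * cheb (Suc n) - cheb n"

lemma degree_cheb: "degree (cheb n) \<le> n"
proof (induction n rule: cheb.induct)
  case (3 n)
  have "degree ([:0, 2:] * cheb (Suc n)) \<le> Suc (Suc n)"
    using degree_mult_le[of "[:0, 2:]" "cheb (Suc n)"] 3 by simp
  then show ?case
    using 3 by (auto intro!: degree_diff_le simp del: mult_pCons_left)
qed auto

text \<open>The identity \<open>T_n (cos t) = cos (n t)\<close> in exponential form. With
  \<open>|u| = 1\<close> it bounds \<open>cheb n\<close> on \<open>\<Gamma>\<close> by 1, with
  \<open>|u| = \<kappa>\<close> it makes \<open>cheb n\<close> large on the ellipse.\<close>

lemma poly_cheb_joukowski:
  assumes "u \<noteq> 0"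
  shows "poly (cheb n) (joukowski u) = (u ^ n + inverse u ^ n) / 2"
proof (induction n rule: cheb.induct)
  case (3 n)
  define w where "w = inverse u"
  have "u * w ^ Suc n = w ^ n" "w * u ^ Suc n = u ^ n"
    using assms by (simp_all add: w_def)
  moreover have "poly (cheb (Suc (Suc n))) (joukowski u)
      = (u + w) * ((u ^ Suc n + w ^ Suc n) / 2) - (u ^ n + w ^ n) / 2"
  proof -
    have "poly (cheb (Suc (Suc n))) (joukowski u)
        = 2 * joukowski u * poly (cheb (Suc n)) (joukowski u) - poly (cheb n) (joukowski u)"
      by simp
    then show ?thesis unfolding 3 by (simp add: joukowski_def w_def)
  qed
  moreover have "(u + w) * (u ^ Suc n + w ^ Suc n)
      = u ^ Suc (Suc n) + w ^ Suc (Suc n) + (u * w ^ Suc n + w * u ^ Suc n)"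
    by (simp add: algebra_simps)
  ultimately show ?case
    unfolding w_def[symmetric] by (simp only: times_divide_eq_right) (simp add: add_divide_distrib)
qed (use assms in \<open>auto simp: joukowski_def\<close>)

lemma joukowski_cis: "joukowski (cis t) = complex_of_real (cos t)"
  by (simp add: joukowski_def complex_eq_iff)

lemma norm_poly_cheb_le_1:
  assumes "x \<in> \<Gamma>"
  shows "cmod (poly (cheb n) (complex_of_real x)) \<le> 1"
proof -
  define u where "u = cis (arccos x)"
  have u: "u \<noteq> 0" "cmod u = 1" by (auto simp: u_def)
  have x: "complex_of_real x = joukowski u"
    using assms by (simp add: u_def joukowski_cis)
  have "cmod (u ^ n + inverse u ^ n) \<le> 2"
    using norm_triangle_ineq[of "u ^ n" "inverse u ^ n"] u by (simp add: norm_power norm_inverse)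
  then show ?thesis
    unfolding x by (simp add: poly_cheb_joukowski u)
qed

lemma norm_poly_cheb_ge:
  assumes "cmod u = \<kappa>" "\<kappa> > 1"
  shows "cmod (poly (cheb n) (joukowski u)) \<ge> (\<kappa> ^ n - inverse \<kappa> ^ n) / 2"
proof -
  have u: "u \<noteq> 0" using assms by auto
  have "cmod (u ^ n) - cmod (inverse u ^ n) \<le> cmod (u ^ n + inverse u ^ n)"
    by (rule norm_diff_ineq)
  then show ?thesis
    by (simp add: poly_cheb_joukowski u assms norm_power norm_inverse)
qed

text \<open>Writing \<open>x\<close> as the image of a unit number \<open>w\<close>, the difference
  factors as \<open>(u - w) (u - 1/w) / (2 u)\<close>, and both numerator factors have modulus at
  least \<open>\<kappa> - 1\<close>.\<close>

lemma norm_joukowski_diff_ge: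
  assumes "cmod u = \<kappa>" "\<kappa> > 1" "x \<in> \<Gamma>"
  shows "cmod (joukowski u - complex_of_real x) \<ge> (\<kappa> - 1)\<^sup>2 / (2 * \<kappa>)"
proof -
  define w where "w = cis (arccos x)"
  have w: "w \<noteq> 0" "cmod w = 1" by (auto simp: w_def)
  have u: "u \<noteq> 0" using assms by auto
  have x: "complex_of_real x = joukowski w"
    using assms by (simp add: w_def joukowski_cis)
  have eq: "joukowski u - joukowski w = (u - w) * (u - inverse w) / (2 * u)"
    using u w by (simp add: joukowski_def field_simps)
  have "\<kappa> - 1 \<le> cmod (u - w)" "\<kappa> - 1 \<le> cmod (u - inverse w)"
    using norm_triangle_ineq2[of u w] norm_triangle_ineq2[of u "inverse w"] w assms
    by (auto simp: norm_inverse)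
  then have "(\<kappa> - 1)\<^sup>2 \<le> cmod (u - w) * cmod (u - inverse w)"
    unfolding power2_eq_square using assms by (intro mult_mono) auto
  then show ?thesis
    unfolding x eq using assms by (simp add: norm_mult norm_divide divide_right_mono)
qed

text \<open>The Bernstein ellipse with foci -1 and 1 and sum of semi-axes \<open>\<kappa>\<close>
  (for \<open>\<kappa> > 1\<close>), parametrised over the unit interval.\<close>

definition ellipse :: "real \<Rightarrow> real \<Rightarrow> complex" where
  "ellipse \<kappa> = joukowski \<circ> circlepath 0 \<kappa>"

lemma circlepath_0_eq: "circlepath 0 \<kappa> t = complex_of_real \<kappa> * cis (2 * pi * t)"
  by (simp add: circlepath cis_conv_exp mult_ac)

lemma joukowski_holomorphic: "joukowski holomorphic_on - {0}"
  unfolding joukowski_def by (intro holomorphic_intros) auto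

lemma has_field_derivative_joukowski:
  assumes "u \<noteq> 0"
  shows "(joukowski has_field_derivative (1 - inverse u ^ 2) / 2) (at u)"
  unfolding joukowski_def using assms
  by (auto intro!: derivative_eq_intros simp: power2_eq_square)

lemma norm_circlepath_0: "\<kappa> > 0 \<Longrightarrow> cmod (circlepath 0 \<kappa> t) = \<kappa>"
  by (simp add: circlepath_0_eq norm_mult)

lemma circlepath_0_nonzero: "\<kappa> > 0 \<Longrightarrow> circlepath 0 \<kappa> t \<noteq> 0"
  using norm_circlepath_0[of \<kappa> t] by force

lemma valid_path_ellipse:
  assumes "\<kappa> > 0"
  shows "valid_path (ellipse \<kappa>)"
  unfolding ellipse_def using assms
  by (intro valid_path_compose_holomorphic[OF _ joukowski_holomorphic])
     (auto simp: path_image_def circlepath_0_nonzero)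

lemma ellipse_loop: "pathfinish (ellipse \<kappa>) = pathstart (ellipse \<kappa>)"
  by (simp add: ellipse_def pathfinish_def pathstart_def circlepath)

lemma ellipse_coords:
  assumes "\<kappa> > 0"
  shows "Re (ellipse \<kappa> t) = (\<kappa> + 1/\<kappa>) / 2 * cos (2 * pi * t)"
        "Im (ellipse \<kappa> t) = (\<kappa> - 1/\<kappa>) / 2 * sin (2 * pi * t)"
proof -
  have coords:
    "Re ((complex_of_real k * cis \<theta> + complex_of_real l * cis (- \<theta>)) / 2) = (k + l) / 2 * cos \<theta>"
    "Im ((complex_of_real k * cis \<theta> + complex_of_real l * cis (- \<theta>)) / 2) = (k - l) / 2 * sin \<theta>"
    for k l \<theta>
    by (simp_all add: algebra_simps)
  have "inverse (complex_of_real \<kappa> * cis \<theta>) = complex_of_real (1 / \<kappa>) * cis (- \<theta>)" for \<theta>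
    unfolding inverse_mult_distrib cis_inverse by (simp add: divide_inverse)
  then have "ellipse \<kappa> t = (complex_of_real \<kappa> * cis (2 * pi * t)
      + complex_of_real (1 / \<kappa>) * cis (- (2 * pi * t))) / 2"
    unfolding ellipse_def o_def circlepath_0_eq joukowski_def by simp
  then show "Re (ellipse \<kappa> t) = (\<kappa> + 1/\<kappa>) / 2 * cos (2 * pi * t)"
    "Im (ellipse \<kappa> t) = (\<kappa> - 1/\<kappa>) / 2 * sin (2 * pi * t)"
    by (simp_all only: coords)
qed

definition ellipse_deriv :: "real \<Rightarrow> real \<Rightarrow> complex" where
  "ellipse_deriv \<kappa> t = 2 * of_real pi * \<i> * circlepath 0 \<kappa> t * ((1 - inverse (circlepath 0 \<kappa> t) ^ 2) / 2)"

lemma vector_derivative_ellipse: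
  assumes "\<kappa> > 0"
  shows "vector_derivative (ellipse \<kappa>) (at t) = ellipse_deriv \<kappa> t"
proof (rule vector_derivative_at)
  have "(circlepath 0 \<kappa> has_vector_derivative 2 * of_real pi * \<i> * circlepath 0 \<kappa> t) (at t)"
    using has_vector_derivative_circlepath[of 0 \<kappa> t UNIV] by (simp add: circlepath mult_ac)
  from field_vector_diff_chain_at[OF this has_field_derivative_joukowski]
  show "(ellipse \<kappa> has_vector_derivative ellipse_deriv \<kappa> t) (at t)"
    using assms by (simp add: ellipse_def ellipse_deriv_def circlepath_0_nonzero)
qed

lemma norm_ellipse_deriv:
  assumes "\<kappa> > 0"
  shows "cmod (ellipse_deriv \<kappa> t) \<le> pi * (\<kappa> + 1 / \<kappa>)"
proof -
  let ?c = "circlepath 0 \<kappa> t"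
  have "cmod (1 - inverse ?c ^ 2) \<le> 1 + inverse \<kappa> ^ 2"
    using norm_triangle_ineq4[of 1 "inverse ?c ^ 2"] norm_circlepath_0[OF assms, of t]
    by (simp add: norm_power norm_inverse)
  then have "cmod (ellipse_deriv \<kappa> t) \<le> 2 * pi * \<kappa> * ((1 + inverse \<kappa> ^ 2) / 2)"
    unfolding ellipse_deriv_def norm_mult norm_divide
    using assms by (simp add: norm_circlepath_0 mult_left_mono)
  also have "\<dots> = pi * (\<kappa> + 1 / \<kappa>)"
    using assms by (simp add: field_simps power2_eq_square)
  finally show ?thesis .
qed

text \<open>The straight-line homotopy from the circle to the ellipse avoids
  \<open>\<Gamma>\<close>: each intermediate curve is an ellipse with semi-axes \<open>A > 1\<close>
  and \<open>B > 0\<close>, which meets the real axis only at \<open>-A\<close> and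
  \<open>A\<close>.\<close>

lemma winding_number_ellipse:
  assumes "\<kappa> > 1" "x \<in> \<Gamma>"
  shows "winding_number (ellipse \<kappa>) (complex_of_real x) = 1"
proof -
  have "winding_number (ellipse \<kappa>) (complex_of_real x)
      = winding_number (circlepath 0 \<kappa>) (complex_of_real x)"
  proof (rule winding_number_loops_linear_eq)
    fix t :: real
    show "complex_of_real x \<notin> closed_segment (circlepath 0 \<kappa> t) (ellipse \<kappa> t)"
    proof
      assume "complex_of_real x \<in> closed_segment (circlepath 0 \<kappa> t) (ellipse \<kappa> t)"
      then obtain u where u: "0 \<le> u" "u \<le> 1"
        "complex_of_real x = (1 - u) *\<^sub>R circlepath 0 \<kappa> t + u *\<^sub>R ellipse \<kappa> t"
        by (auto simp: closed_segment_def)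
      define A where "A = (1 - u) * \<kappa> + u * ((\<kappa> + 1/\<kappa>) / 2)"
      define B where "B = (1 - u) * \<kappa> + u * ((\<kappa> - 1/\<kappa>) / 2)"
      have "0 < (\<kappa> - 1)\<^sup>2" using assms by simp
      then have a: "1 < (\<kappa> + 1/\<kappa>) / 2" using assms by (simp add: field_simps power2_eq_square)
      have "1 / \<kappa> < 1" using assms by simp
      also have "1 < \<kappa>" using assms by simp
      finally have b: "0 < (\<kappa> - 1/\<kappa>) / 2" by simp
      \<comment> \<open>\<open>convex_bound_lt\<close> bounds convex combinations from above; hence
        the negated arguments.\<close>
      have A: "A > 1"
        using convex_bound_lt[of "-\<kappa>" "-1" "- ((\<kappa> + 1/\<kappa>) / 2)" "1 - u" u] a assms u
        unfolding A_def mult_minus_right by linarith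
      have B: "B > 0"
        using convex_bound_lt[of "-\<kappa>" "0" "- ((\<kappa> - 1/\<kappa>) / 2)" "1 - u" u] b assms u
        unfolding B_def mult_minus_right by linarith
      have "x = A * cos (2 * pi * t)" "0 = B * sin (2 * pi * t)"
        using arg_cong[OF u(3), of Re] arg_cong[OF u(3), of Im] assms ellipse_coords[of \<kappa> t]
        by (simp_all add: circlepath_0_eq A_def B_def algebra_simps)
      then have "\<bar>cos (2 * pi * t)\<bar> = 1" "\<bar>x\<bar> = A * \<bar>cos (2 * pi * t)\<bar>"
        using B A sin_zero_abs_cos_one[of "2 * pi * t"] by (auto simp: abs_mult)
      then show False using A assms by auto
    qed
  qed (use assms in \<open>auto simp: ellipse_loop valid_path_ellipse valid_path_imp_path\<close>)
  also have "\<dots> = 1"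
    using assms by (intro winding_number_circlepath) auto
  finally show ?thesis .
qed

section \<open>Geometry of the neighbourhoods of the interval\<close>

lemma Sigma_nbhd_I:
  assumes "x \<in> \<Gamma>" "dist z (complex_of_real x) \<le> t"
  shows "z \<in> \<Sigma>_nbhd t"
  unfolding \<Sigma>_nbhd_def using assms infdist_le2[of "complex_of_real x"] by auto

lemma compact_of_real_Gamma: "compact (complex_of_real ` \<Gamma>)"
  by (intro compact_continuous_image continuous_intros) auto

text \<open>The distance to a closed set is attained, so the neighbourhood is the Minkowski sum of
  the segment and a disc. Convexity (for Cauchy's formula) and compactness (for a finite supremum)
  are inherited from the summands.\<close>

lemma Sigma_nbhd_eq: "\<Sigma>_nbhd t = (\<Union>x\<in>complex_of_real ` \<Gamma>. \<Union>y\<in>cball 0 t. {x + y})"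
proof (intro equalityI subsetI)
  fix z assume "z \<in> \<Sigma>_nbhd t"
  then have "infdist z (complex_of_real ` \<Gamma>) \<le> t" by (simp add: \<Sigma>_nbhd_def)
  moreover obtain y where "y \<in> complex_of_real ` \<Gamma>" "infdist z (complex_of_real ` \<Gamma>) = dist z y"
    by (rule infdist_attains_inf[OF compact_imp_closed[OF compact_of_real_Gamma], of z]) auto
  ultimately show "z \<in> (\<Union>x\<in>complex_of_real ` \<Gamma>. \<Union>y\<in>cball 0 t. {x + y})"
    by (intro UN_I[of y] UN_I[of "z - y"]) (auto simp: dist_norm norm_minus_commute)
next
  fix z assume "z \<in> (\<Union>x\<in>complex_of_real ` \<Gamma>. \<Union>y\<in>cball 0 t. {x + y})"
  then obtain x y where "x \<in> \<Gamma>" "cmod y \<le> t" "z = complex_of_real x + y" by auto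
  then show "z \<in> \<Sigma>_nbhd t" by (intro Sigma_nbhd_I[of x]) (auto simp: dist_norm)
qed

lemma convex_Sigma_nbhd: "convex (\<Sigma>_nbhd t)"
  unfolding Sigma_nbhd_eq
  by (intro convex_sums convex_linear_image) (auto simp: linear_iff scaleR_conv_of_real)

lemma compact_Sigma_nbhd: "compact (\<Sigma>_nbhd t)"
proof -
  have "\<Sigma>_nbhd t = {x + y | x y. x \<in> complex_of_real ` \<Gamma> \<and> y \<in> cball 0 t}"
    unfolding Sigma_nbhd_eq by blast
  then show ?thesis using compact_sums[OF compact_of_real_Gamma compact_cball, of 0 t] by simp
qed

lemma of_real_in_Sigma_nbhd:
  assumes "x \<in> \<Gamma>" "t \<ge> 0"
  shows "complex_of_real x \<in> \<Sigma>_nbhd t"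
  using assms by (intro Sigma_nbhd_I) auto

lemma of_real_in_interior_Sigma_nbhd:
  assumes "x \<in> \<Gamma>" "t > 0"
  shows "complex_of_real x \<in> interior (\<Sigma>_nbhd t)"
proof -
  have "ball (complex_of_real x) t \<subseteq> \<Sigma>_nbhd t"
    using assms by (auto intro!: Sigma_nbhd_I simp: dist_commute)
  then show ?thesis using assms by (meson centre_in_ball interior_maximal open_ball subset_iff)
qed

text \<open>Since \<open>1 / \<kappa> = sqrt (1 + \<tau>\<^sup>2) - \<tau>\<close>, the ellipse has
  semi-axes \<open>sqrt (1 + \<tau>\<^sup>2)\<close> and \<open>\<tau>\<close>: its height is that
  of the neighbourhood.\<close>

locale bernstein_ellipse =
  fixes \<tau> \<kappa> :: real
  assumes tau_pos: "\<tau> > 0" and kappa_eq: "\<kappa> = \<tau> + sqrt (1 + \<tau>\<^sup>2)"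
begin

lemma kappa_gt_1: "\<kappa> > 1"
proof -
  have "1 \<le> sqrt (1 + \<tau>\<^sup>2)" by simp
  then show ?thesis using tau_pos unfolding kappa_eq by linarith
qed

lemma inverse_kappa: "1 / \<kappa> = sqrt (1 + \<tau>\<^sup>2) - \<tau>"
proof -
  have "\<kappa> * (sqrt (1 + \<tau>\<^sup>2) - \<tau>) = 1"
    by (simp add: kappa_eq algebra_simps power2_eq_square flip: power2_eq_square)
  then show ?thesis using kappa_gt_1 by (simp add: field_simps)
qed

text \<open>The point with parameter angle \<open>s\<close> is compared with \<open>cos s\<close> in
  \<open>\<Gamma>\<close>: the real parts differ by at most \<open>(a - 1) |cos s|\<close> with
  \<open>a - 1 \<le> \<tau>\<close>, the imaginary parts by \<open>\<tau> |sin s|\<close>.\<close>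

lemma ellipse_in_Sigma_nbhd: "ellipse \<kappa> t \<in> \<Sigma>_nbhd \<tau>"
proof (rule Sigma_nbhd_I)
  define a c s where "a = sqrt (1 + \<tau>\<^sup>2)" and "c = cos (2 * pi * t)" and "s = sin (2 * pi * t)"
  have coords: "Re (ellipse \<kappa> t) = a * c" "Im (ellipse \<kappa> t) = \<tau> * s"
    using ellipse_coords[of \<kappa> t] kappa_gt_1 inverse_kappa by (auto simp: kappa_eq a_def c_def s_def)
  have "a \<le> 1 + \<tau>"
    unfolding a_def using tau_pos
    by (intro real_le_lsqrt) (auto simp: power2_eq_square algebra_simps)
  then have a: "1 \<le> a" "a - 1 \<le> \<tau>"
    by (auto simp: a_def)
  have "(cmod (ellipse \<kappa> t - complex_of_real c))\<^sup>2 = (a - 1)\<^sup>2 * c\<^sup>2 + \<tau>\<^sup>2 * s\<^sup>2"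
    by (simp add: cmod_power2 coords power_mult_distrib flip: left_diff_distrib)
       (simp add: algebra_simps power2_eq_square)
  also have "\<dots> \<le> \<tau>\<^sup>2 * c\<^sup>2 + \<tau>\<^sup>2 * s\<^sup>2"
    using a by (intro add_mono mult_right_mono power_mono) auto
  also have "\<dots> = \<tau>\<^sup>2"
    by (simp add: c_def s_def flip: distrib_left)
  finally have "cmod (ellipse \<kappa> t - complex_of_real c) \<le> \<tau>"
    using tau_pos by (auto intro: power2_le_imp_le)
  then show "dist (ellipse \<kappa> t) (complex_of_real (cos (2 * pi * t))) \<le> \<tau>"
    by (simp add: dist_norm c_def)
qed simp

lemma cauchy_ellipse:
  assumes "v holomorphic_on \<Sigma>_nbhd \<tau>" "x \<in> \<Gamma>"
  shows "((\<lambda>t. v (ellipse \<kappa> t) / (ellipse \<kappa> t - x) * ellipse_deriv \<kappa> t) has_integral 2 * of_real pi * \<i> * v x) {0..1}"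
proof -
  have "ellipse \<kappa> t \<noteq> x" for t
  proof
    assume *: "ellipse \<kappa> t = x"
    have "(\<kappa> - 1)\<^sup>2 / (2 * \<kappa>) \<le> cmod (ellipse \<kappa> t - x)"
      unfolding ellipse_def o_def
      using assms kappa_gt_1 by (intro norm_joukowski_diff_ge) (auto simp: norm_circlepath_0)
    moreover have "(\<kappa> - 1)\<^sup>2 / (2 * \<kappa>) > 0" using kappa_gt_1 by simp
    ultimately show False using * by simp
  qed
  then have "path_image (ellipse \<kappa>) \<subseteq> \<Sigma>_nbhd \<tau> - {complex_of_real x}"
    using ellipse_in_Sigma_nbhd by (auto simp: path_image_def)
  then have "((\<lambda>z. v z / (z - x)) has_contour_integral
      complex_of_real (2 * pi) * \<i> * winding_number (ellipse \<kappa>) x * v x) (ellipse \<kappa>)"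
    using assms tau_pos kappa_gt_1
    by (intro Cauchy_integral_formula_convex_simple[OF convex_Sigma_nbhd])
       (auto simp: of_real_in_interior_Sigma_nbhd valid_path_ellipse ellipse_loop)
  then show ?thesis
    using assms kappa_gt_1
    by (simp add: winding_number_ellipse has_contour_integral vector_derivative_ellipse)
qed

text \<open>
  The approximant interpolates \<open>v\<close> at the zeros of the Chebyshev polynomial \<open>T\<close> of degree \<open>n + 1\<close>;
  by Cauchy's formula its error at \<open>x\<close> is the contour integral of \<open>v z * T x / (T z * (z - x))\<close>.
\<close>

lemma chebyshev_approximation:
  assumes v: "v holomorphic_on \<Sigma>_nbhd \<tau>" and M: "\<And>z. z \<in> \<Sigma>_nbhd \<tau> \<Longrightarrow> cmod (v z) \<le> M"
  shows "\<exists>P. degree P \<le> n \<and>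
    (\<forall>x\<in>\<Gamma>. cmod (v (complex_of_real x) - poly P (complex_of_real x))
       \<le> 4 / (1 - 1 / \<kappa>) ^ 3 * (1 / \<kappa>) ^ n * M)"
proof -
  define e where "e = ellipse \<kappa>"
  define T where "T = cheb (Suc n)"
  \<comment> \<open>\<open>L\<close> bounds \<open>|T|\<close> on the ellipse from below,
    \<open>D\<close> the distance of the ellipse from \<open>\<Gamma>\<close>. The
    \<open>d j z\<close> are the coefficients, as a polynomial in \<open>x\<close>, of the divided
    difference \<open>(T z - T x) / (z - x)\<close>; integrating them against \<open>v / T\<close>
    gives the coefficients of the interpolant \<open>P\<close>.\<close>
  define L where "L = (\<kappa> ^ Suc n - inverse \<kappa> ^ Suc n) / 2"
  define D where "D = (\<kappa> - 1)\<^sup>2 / (2 * \<kappa>)"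
  define d where "d = (\<lambda>j z. \<Sum>i=Suc j..Suc n. coeff T i * z ^ (i - j - 1))"
  define b where "b = (\<lambda>j. integral {0..1} (\<lambda>t. v (e t) / poly T (e t) * d j (e t) * ellipse_deriv \<kappa> t))"
  define P where "P = (\<Sum>j<Suc n. monom (b j / (2 * of_real pi * \<i>)) j)"
  have kappa: "\<kappa> > 1" by (rule kappa_gt_1)
  have "inverse \<kappa> ^ Suc n < 1 ^ Suc n"
    using kappa by (intro power_strict_mono) (auto simp: field_simps)
  moreover have "1 \<le> \<kappa> ^ Suc n" using kappa by (intro one_le_power) simp
  ultimately have L: "L > 0" by (simp add: L_def)
  have D: "D > 0" using kappa by (simp add: D_def)
  have T_ge: "cmod (poly T (e t)) \<ge> L" for t
    unfolding e_def ellipse_def o_def T_def L_def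
    using kappa by (intro norm_poly_cheb_ge) (auto simp: norm_circlepath_0)
  then have T_nz: "poly T (e t) \<noteq> 0" for t using L by (metis norm_zero not_less)
  have D_le: "cmod (e t - complex_of_real x) \<ge> D" if "x \<in> \<Gamma>" for x t
    unfolding e_def ellipse_def o_def D_def
    using kappa that by (intro norm_joukowski_diff_ge) (auto simp: norm_circlepath_0)
  have e_in: "e t \<in> \<Sigma>_nbhd \<tau>" for t
    unfolding e_def by (rule ellipse_in_Sigma_nbhd)
  have cont_c: "continuous_on {0..1} (circlepath 0 \<kappa>)"
    using path_circlepath by (simp add: path_def)
  have cont_e: "continuous_on {0..1} e"
    unfolding e_def using valid_path_imp_path[OF valid_path_ellipse, of \<kappa>] kappa by (simp add: path_def)
  have cont_e': "continuous_on {0..1} (ellipse_deriv \<kappa>)"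
    unfolding ellipse_deriv_def
    using kappa by (intro continuous_intros cont_c) (auto simp: circlepath_0_nonzero)
  have cont_v: "continuous_on {0..1} (\<lambda>t. v (e t))"
    using continuous_on_compose2[OF holomorphic_on_imp_continuous_on[OF v] cont_e] e_in by auto
  have b: "((\<lambda>t. v (e t) / poly T (e t) * d j (e t) * ellipse_deriv \<kappa> t) has_integral b j) {0..1}" for j
    unfolding b_def d_def
    by (intro integrable_integral integrable_continuous_real continuous_intros cont_v cont_e cont_e' T_nz ballI)
  have P: "degree P \<le> n"
    unfolding P_def by (intro degree_sum_le) (auto intro: order.trans[OF degree_monom_le])
  have poly_T: "poly T z = (\<Sum>i\<le>Suc n. coeff T i * z ^ i)" for z
    unfolding poly_altdef T_def
    by (rule sum.mono_neutral_left) (use degree_cheb[of "Suc n"] in \<open>auto simp: coeff_eq_0\<close>)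
  \<comment> \<open>The first factor is the bound \<open>pi * (\<kappa> + 1 / \<kappa>)\<close> on
    the speed of the contour divided by the \<open>2 * pi\<close> of Cauchy's formula.\<close>
  have main: "cmod (v (of_real x) - poly P (of_real x)) \<le> (\<kappa> + 1 / \<kappa>) / 2 * (M / (D * L))" if x: "x \<in> \<Gamma>" for x :: real
  proof -
    let ?x = "complex_of_real x"
    have T_diff: "poly T z - poly T ?x = (z - ?x) * (\<Sum>j<Suc n. d j z * ?x ^ j)" for z
      using polyfun_diff[of "Suc n" "coeff T" ?x z]
      unfolding poly_T d_def by (simp add: algebra_simps del: sum.atMost_Suc sum.lessThan_Suc)
    have M0: "0 \<le> M" using M[OF e_in[of 0]] norm_ge_zero order.trans by blast
    have "((\<lambda>t. v (e t) / (e t - ?x) * ellipse_deriv \<kappa> t -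
         (\<Sum>j<Suc n. v (e t) / poly T (e t) * d j (e t) * ellipse_deriv \<kappa> t * ?x ^ j))
       has_integral 2 * of_real pi * \<i> * v ?x - (\<Sum>j<Suc n. b j * ?x ^ j)) {0..1}"
      unfolding e_def[symmetric]
      by (intro has_integral_diff has_integral_sum has_integral_mult_left b
            cauchy_ellipse[OF v x, folded e_def]) auto
    moreover have "v (e t) / (e t - ?x) * ellipse_deriv \<kappa> t -
         (\<Sum>j<Suc n. v (e t) / poly T (e t) * d j (e t) * ellipse_deriv \<kappa> t * ?x ^ j)
       = v (e t) * ellipse_deriv \<kappa> t * poly T ?x / (poly T (e t) * (e t - ?x))" (is "?l = ?r") for t
    proof -
      have nz: "e t - ?x \<noteq> 0" using D_le[OF x, of t] D by auto
      define S where "S = (\<Sum>j<Suc n. d j (e t) * ?x ^ j)"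
      have "?l = v (e t) * ellipse_deriv \<kappa> t * (1 / (e t - ?x) - S / poly T (e t))"
        unfolding S_def sum_divide_distrib right_diff_distrib sum_distrib_left
        by (simp add: mult_ac del: sum.lessThan_Suc)
      also have "S = (poly T (e t) - poly T ?x) / (e t - ?x)"
        using nz unfolding T_diff S_def by simp
      also have "1 / (e t - ?x) - (poly T (e t) - poly T ?x) / (e t - ?x) / poly T (e t)
          = poly T ?x / (poly T (e t) * (e t - ?x))"
        using nz T_nz[of t] by (simp add: diff_divide_distrib)
      finally show ?thesis by simp
    qed
    ultimately have int: "((\<lambda>t. v (e t) * ellipse_deriv \<kappa> t * poly T ?x / (poly T (e t) * (e t - ?x)))
       has_integral 2 * of_real pi * \<i> * v ?x - (\<Sum>j<Suc n. b j * ?x ^ j)) {0..1}"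
      by simp
    have "cmod (2 * of_real pi * \<i> * v ?x - (\<Sum>j<Suc n. b j * ?x ^ j))
        \<le> M * (pi * (\<kappa> + 1 / \<kappa>)) * 1 / (L * D) * measure lborel {0..1::real}"
    proof (rule has_integral_bound_real[OF _ finite.emptyI int])
      show "0 \<le> M * (pi * (\<kappa> + 1 / \<kappa>)) * 1 / (L * D)"
        using M0 L D kappa by simp
      fix t :: real
      show "cmod (v (e t) * ellipse_deriv \<kappa> t * poly T ?x / (poly T (e t) * (e t - ?x)))
          \<le> M * (pi * (\<kappa> + 1 / \<kappa>)) * 1 / (L * D)"
        unfolding norm_mult norm_divide
        using L D kappa M0
        by (intro frac_le mult_mono M e_in norm_ellipse_deriv T_ge D_le x mult_nonneg_nonneg)
           (auto simp: T_def intro!: norm_poly_cheb_le_1 x[simplified] mult_nonneg_nonneg)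
    qed
    also have "(\<Sum>j<Suc n. b j * ?x ^ j) = 2 * of_real pi * \<i> * poly P ?x"
      unfolding P_def poly_sum sum_distrib_left
      by (intro sum.cong) (auto simp: poly_monom)
    also have "2 * of_real pi * \<i> * v ?x - 2 * of_real pi * \<i> * poly P ?x = 2 * of_real pi * \<i> * (v ?x - poly P ?x)"
      by (simp add: algebra_simps)
    finally have "2 * pi * cmod (v ?x - poly P ?x) \<le> M * (pi * (\<kappa> + 1 / \<kappa>)) / (L * D)"
      by (simp add: norm_mult)
    also have "\<dots> = 2 * pi * ((\<kappa> + 1 / \<kappa>) / 2 * (M / (D * L)))"
    proof -
      have "M * (pi * K) / (L * D) = 2 * pi * (K / 2 * (M / (D * L)))" for K
        by (simp add: mult_ac)
      then show ?thesis .
    qed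
    finally show ?thesis by (rule mult_left_le_imp_le) simp
  qed
  show ?thesis
  proof (intro exI[of _ P] conjI P ballI)
    fix x :: real assume x: "x \<in> \<Gamma>"
    \<comment> \<open>Origin of the constant: the geometric factor is
      \<open>(1 + y\<^sup>2) / (1 - y)\<^sup>2 \<le> 2 / (1 - y)\<^sup>2\<close>, and \<open>1 / L =
      2 * y ^ Suc n / (1 - y ^ (2 * n + 2)) \<le> 2 * y ^ n / (1 - y)\<close>. Their product is
      \<open>4 / (1 - y) ^ 3 * y ^ n\<close>.\<close>
    define y where "y = 1 / \<kappa>"
    have y: "0 < y" "y < 1" "\<kappa> = 1 / y" using kappa by (auto simp: y_def)
    have M0: "0 \<le> M" using M[OF e_in[of 0]] norm_ge_zero order.trans by blast
    have "D = (1 - y)\<^sup>2 / (2 * y)"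
      using y by (simp add: D_def y(3) field_simps power2_eq_square)
    moreover have "(\<kappa> + 1 / \<kappa>) / 2 = (1 + y\<^sup>2) / (2 * y)"
      using y by (simp add: y(3) field_simps power2_eq_square)
    ultimately have "(\<kappa> + 1 / \<kappa>) / 2 / D = (1 + y\<^sup>2) / (2 * y) / ((1 - y)\<^sup>2 / (2 * y))"
      by (simp only:)
    also have "\<dots> = (1 + y\<^sup>2) / (1 - y)\<^sup>2"
      using y by simp
    also have "\<dots> \<le> 2 / (1 - y)\<^sup>2"
      using y by (intro divide_right_mono) (auto simp: power2_eq_square mult_le_one)
    finally have 1: "(\<kappa> + 1 / \<kappa>) / 2 / D \<le> 2 / (1 - y)\<^sup>2" .
    have a: "y ^ Suc n * y ^ Suc n \<le> y"
      using y by (simp add: mult_le_one mult_left_le power_le_one)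
    have "1 / L \<le> 2 * y ^ Suc n / (1 - y)"
    proof -
      define z where "z = y ^ Suc n"
      have z: "z > 0" using y by (simp add: z_def)
      have "L = (1 / z - z) / 2"
        by (simp add: L_def y(3) z_def power_one_over del: power_Suc)
      also have "\<dots> = (1 - z * z) / (2 * z)"
        using z by (simp add: field_simps)
      finally have "1 / L = 2 * y ^ Suc n / (1 - y ^ Suc n * y ^ Suc n)"
        by (simp only: z_def) simp
      also have "\<dots> \<le> 2 * y ^ Suc n / (1 - y)"
      proof (intro divide_left_mono mult_pos_pos)
        show "0 < 1 - y ^ Suc n * y ^ Suc n" "1 - y \<le> 1 - y ^ Suc n * y ^ Suc n"
          using a y by linarith+
      qed (use y in auto)
      finally show ?thesis .
    qed
    also have "\<dots> \<le> 2 * y ^ n / (1 - y)"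
      using y by (intro divide_right_mono) (auto simp: mult_left_le_one_le)
    finally have 2: "1 / L \<le> 2 * y ^ n / (1 - y)" .
    have "(\<kappa> + 1 / \<kappa>) / 2 / D * (1 / L) \<le> 2 / (1 - y)\<^sup>2 * (2 * y ^ n / (1 - y))"
      using 1 2 y L by (intro mult_mono) auto
    also have "\<dots> = 4 / (1 - y) ^ 3 * y ^ n"
      by (simp add: power2_eq_square power3_eq_cube)
    finally have "(\<kappa> + 1 / \<kappa>) / 2 / D * (1 / L) * M \<le> 4 / (1 - y) ^ 3 * y ^ n * M"
      using M0 by (rule mult_right_mono)
    then show "cmod (v x - poly P x) \<le> 4 / (1 - 1 / \<kappa>) ^ 3 * (1 / \<kappa>) ^ n * M"
      using main[OF x] by (simp add: y_def)
  qed
qed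

end

subsection \<open>Tensor products of functionals\<close>

text \<open>Covers quadratures and their differences. Being finite sums of point values, such
  functionals are linear on all functions, so their tensor products raise no question of
  measurability.\<close>

definition node_op :: "((real \<Rightarrow> real) \<Rightarrow> real) \<Rightarrow> bool" where
  "node_op L \<longleftrightarrow> (\<exists>P c. finite P \<and> P \<subseteq> \<Gamma> \<and> (\<forall>v. L v = (\<Sum>x\<in>P. c x * v x)))"

text \<open>The complex-linear extension of a real functional. It reads only values at real points,
  but these are complex once the other variables are.\<close>

definition complexify :: "((real \<Rightarrow> real) \<Rightarrow> real) \<Rightarrow> (complex \<Rightarrow> complex) \<Rightarrow> complex" where
  "complexify L V = Complex (L (\<lambda>t. Re (V (of_real t)))) (L (\<lambda>t. Im (V (of_real t))))"

text \<open>An operator norm bound with respect to the supremum norm of analytic functions on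
  \<open>S\<close>, stated for every upper bound \<open>M\<close> to avoid the supremum
  itself.\<close>

definition op_bound :: "complex set \<Rightarrow> ((real \<Rightarrow> real) \<Rightarrow> real) \<Rightarrow> real \<Rightarrow> bool" where
  "op_bound S L b \<longleftrightarrow> (\<forall>V M. V analytic_on S \<and> (\<forall>z\<in>S. cmod (V z) \<le> M) \<longrightarrow> cmod (complexify L V) \<le> b * M)"

text \<open>Of the extension \<open>G\<close> of \<open>g\<close> only separate analyticity and boundedness are ever used.\<close>

definition sep_analytic_ext ::
    "nat \<Rightarrow> (nat \<Rightarrow> complex set) \<Rightarrow> ((nat \<Rightarrow> complex) \<Rightarrow> complex) \<Rightarrow> ((nat \<Rightarrow> real) \<Rightarrow> real) \<Rightarrow> bool" where
  "sep_analytic_ext m S G g \<longleftrightarrow>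
     (\<forall>z\<in>Pi\<^sub>E {1..m} S. \<forall>n\<in>{1..m}. (\<lambda>x. G (z(n := x))) analytic_on S n) \<and>
     (\<forall>y\<in>Pi\<^sub>E {1..m} (\<lambda>_. \<Gamma>). G (\<lambda>i\<in>{1..m}. of_real (y i)) = of_real (g y))"

lemma complexify_sum:
  assumes "finite P" "\<And>v. L v = (\<Sum>x\<in>P. c x * v x)"
  shows "complexify L V = (\<Sum>x\<in>P. of_real (c x) * V (of_real x))"
  by (simp add: complexify_def assms(2) complex_eq_iff)

lemma node_op_sum:
  assumes "node_op L"
  shows "L (\<lambda>t. \<Sum>i\<in>I. h i t) = (\<Sum>i\<in>I. L (h i))"
proof -
  obtain P c where "finite P" "\<And>v. L v = (\<Sum>x\<in>P. c x * v x)"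
    using assms by (auto simp: node_op_def)
  then show ?thesis by (simp add: sum_distrib_left) (rule sum.swap)
qed

lemma node_op_gauss_quad: "node_op (gauss_quad n)"
  unfolding node_op_def gauss_quad_def using gauss_points_eq(2)[of n] by (intro exI[of _ "gauss_points n"]) auto

lemma node_op_diff:
  assumes "node_op L" "node_op L'"
  shows "node_op (\<lambda>v. L v - L' v)"
proof -
  obtain P c where P: "finite P" "P \<subseteq> \<Gamma>" "\<And>v. L v = (\<Sum>x\<in>P. c x * v x)"
    using assms(1) by (auto simp: node_op_def)
  obtain P' c' where P': "finite P'" "P' \<subseteq> \<Gamma>" "\<And>v. L' v = (\<Sum>x\<in>P'. c' x * v x)"
    using assms(2) by (auto simp: node_op_def)
  define d where "d = (\<lambda>x. (if x \<in> P then c x else 0) - (if x \<in> P' then c' x else 0))"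
  have "L v - L' v = (\<Sum>x\<in>P \<union> P'. d x * v x)" for v
  proof -
    have "(\<Sum>x\<in>P. c x * v x) = (\<Sum>x\<in>P \<union> P'. (if x \<in> P then c x else 0) * v x)"
      using P P' by (intro sum.mono_neutral_cong_left) auto
    moreover have "(\<Sum>x\<in>P'. c' x * v x) = (\<Sum>x\<in>P \<union> P'. (if x \<in> P' then c' x else 0) * v x)"
      using P P' by (intro sum.mono_neutral_cong_left) auto
    ultimately show ?thesis
      by (simp add: P P' d_def left_diff_distrib sum_subtractf)
  qed
  then show ?thesis
    unfolding node_op_def using P P' by (intro exI[of _ "P \<union> P'"] exI[of _ d]) auto
qed

lemma node_op_quad_diff: "node_op (quad_diff N j)"
proof (cases "j = 0")
  case True
  then have "quad_diff N j = gauss_quad (N j)" by (simp add: quad_diff_def fun_eq_iff)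
  then show ?thesis by (simp add: node_op_gauss_quad)
next
  case False
  then have "quad_diff N j = (\<lambda>v. gauss_quad (N j) v - gauss_quad (N (j - 1)) v)"
    by (simp add: quad_diff_def fun_eq_iff)
  then show ?thesis by (simp add: node_op_gauss_quad node_op_diff)
qed

lemma PiE_Suc_upd:
  assumes "z \<in> Pi\<^sub>E {1..m} S" "x \<in> S (Suc m)"
  shows "z(Suc m := x) \<in> Pi\<^sub>E {1..Suc m} S"
  using PiE_fun_upd[OF assms(2,1)] by (simp add: atLeastAtMostSuc_conv)

lemma restrict_of_real_upd:
  "(\<lambda>i\<in>{1..m}. complex_of_real (y i))(Suc m := of_real t) = (\<lambda>i\<in>{1..Suc m}. of_real ((y(Suc m := t)) i))"
  by (auto simp: fun_eq_iff)

lemma sep_analytic_ext_slice: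
  assumes "sep_analytic_ext m S G g" "z \<in> Pi\<^sub>E {1..m} S" "n \<in> {1..m}"
  shows "(\<lambda>x. G (z(n := x))) analytic_on S n"
  using assms unfolding sep_analytic_ext_def by blast

lemma sep_analytic_ext_real:
  assumes "sep_analytic_ext m S G g" "y \<in> Pi\<^sub>E {1..m} (\<lambda>_. \<Gamma>)"
  shows "G (\<lambda>i\<in>{1..m}. of_real (y i)) = of_real (g y)"
  using assms unfolding sep_analytic_ext_def by blast

text \<open>The new function is a finite combination of slices at real nodes, which lie in
  \<open>S (Suc m)\<close>. This lets inductions over \<open>tensor_op\<close> peel off the last
  variable.\<close>

lemma sep_analytic_ext_step:
  assumes ext: "sep_analytic_ext (Suc m) S G g" and L: "node_op L"
    and S: "complex_of_real ` \<Gamma> \<subseteq> S (Suc m)"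
  shows "sep_analytic_ext m S (\<lambda>z. complexify L (\<lambda>t. G (z(Suc m := t)))) (\<lambda>y. L (\<lambda>t. g (y(Suc m := t))))"
proof -
  obtain P c where P: "finite P" "P \<subseteq> \<Gamma>" "\<And>v. L v = (\<Sum>x\<in>P. c x * v x)"
    using L by (auto simp: node_op_def)
  show ?thesis
    unfolding sep_analytic_ext_def
  proof (intro conjI ballI)
    fix z n assume z: "z \<in> Pi\<^sub>E {1..m} S" and n: "n \<in> {1..m}"
    have "(\<lambda>x. G ((z(n := x))(Suc m := of_real p))) analytic_on S n" if "p \<in> P" for p
    proof -
      have "z(Suc m := of_real p) \<in> Pi\<^sub>E {1..Suc m} S"
        using z S P that by (intro PiE_Suc_upd) auto
      then have "(\<lambda>x. G ((z(Suc m := of_real p))(n := x))) analytic_on S n"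
        using n by (intro sep_analytic_ext_slice[OF ext]) auto
      then show ?thesis using n by (simp add: fun_upd_twist)
    qed
    then show "(\<lambda>x. complexify L (\<lambda>t. G ((z(n := x))(Suc m := t)))) analytic_on S n"
      unfolding complexify_sum[OF P(1,3)] by (intro analytic_intros) auto
  next
    fix y assume y: "y \<in> Pi\<^sub>E {1..m} (\<lambda>_. \<Gamma>)"
    have "G ((\<lambda>i\<in>{1..m}. of_real (y i))(Suc m := of_real t)) = of_real (g (y(Suc m := t)))"
      if "t \<in> \<Gamma>" for t
      unfolding restrict_of_real_upd
      by (rule sep_analytic_ext_real[OF ext PiE_Suc_upd[OF y that]])
    then show "complexify L (\<lambda>t. G ((\<lambda>i\<in>{1..m}. of_real (y i))(Suc m := t)))
        = of_real (L (\<lambda>t. g (y(Suc m := t))))"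
      unfolding complexify_sum[OF P(1,3)] P(3) using P(2) by (auto intro!: sum.cong)
  qed
qed

lemma sep_analytic_ext_last:
  assumes ext: "sep_analytic_ext (Suc m) S G g" and S: "complex_of_real ` \<Gamma> \<subseteq> S (Suc m)"
    and z: "z \<in> Pi\<^sub>E {1..m} S"
  shows "(\<lambda>t. G (z(Suc m := t))) analytic_on S (Suc m)"
proof -
  \<comment> \<open>The value 0 merely completes \<open>z\<close> to a point of the product; the
    slice overwrites it.\<close>
  have "z(Suc m := of_real 0) \<in> Pi\<^sub>E {1..Suc m} S"
    using z S by (intro PiE_Suc_upd) auto
  from sep_analytic_ext_slice[OF ext this, of "Suc m"] show ?thesis by simp
qed

lemma op_bound_step:
  assumes ext: "sep_analytic_ext (Suc m) S G g" and L: "op_bound (S (Suc m)) L b"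
    and S: "complex_of_real ` \<Gamma> \<subseteq> S (Suc m)"
    and M: "\<And>z. z \<in> Pi\<^sub>E {1..Suc m} S \<Longrightarrow> cmod (G z) \<le> M" and z: "z \<in> Pi\<^sub>E {1..m} S"
  shows "cmod (complexify L (\<lambda>t. G (z(Suc m := t)))) \<le> b * M"
  using L M PiE_Suc_upd[OF z] sep_analytic_ext_last[OF ext S z] by (auto simp: op_bound_def)

text \<open>\<open>tensor_op\<close> applies the functional of the last variable innermost. That
  replaces the extension by one in \<open>m\<close> variables bounded by
  \<open>b (Suc m) * M\<close>, so the norms multiply.\<close>

lemma tensor_op_bound:
  assumes "\<And>n. n \<in> {1..m} \<Longrightarrow> node_op (L n)"
    and "\<And>n. n \<in> {1..m} \<Longrightarrow> op_bound (S n) (L n) (b n)"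
    and "\<And>n. n \<in> {1..m} \<Longrightarrow> complex_of_real ` \<Gamma> \<subseteq> S n"
    and "sep_analytic_ext m S G g"
    and "\<And>z. z \<in> Pi\<^sub>E {1..m} S \<Longrightarrow> cmod (G z) \<le> M"
  shows "\<bar>tensor_op L m g\<bar> \<le> (\<Prod>n=1..m. b n) * M"
  using assms
proof (induction m arbitrary: G g M)
  case 0
  then have "G (\<lambda>i. undefined) = of_real (g (\<lambda>i. undefined))" "cmod (G (\<lambda>i. undefined)) \<le> M"
    by (auto simp: sep_analytic_ext_def restrict_def)
  then show ?case by simp
next
  case (Suc m)
  have S: "complex_of_real ` \<Gamma> \<subseteq> S (Suc m)" using Suc.prems(3) by simp
  have "\<bar>tensor_op L m (\<lambda>y. L (Suc m) (\<lambda>t. g (y(Suc m := t))))\<bar> \<le> (\<Prod>n=1..m. b n) * (b (Suc m) * M)"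
  proof (rule Suc.IH)
    show "sep_analytic_ext m S (\<lambda>z. complexify (L (Suc m)) (\<lambda>t. G (z(Suc m := t))))
        (\<lambda>y. L (Suc m) (\<lambda>t. g (y(Suc m := t))))"
      by (rule sep_analytic_ext_step[OF Suc.prems(4) _ S]) (simp add: Suc.prems)
    show "cmod (complexify (L (Suc m)) (\<lambda>t. G (z(Suc m := t)))) \<le> b (Suc m) * M"
      if "z \<in> Pi\<^sub>E {1..m} S" for z
      by (rule op_bound_step[OF Suc.prems(4) _ S Suc.prems(5) that]) (simp_all add: Suc.prems)
  qed (use Suc.prems in auto)
  then show ?case by (simp add: mult_ac)
qed

lemma tensor_op_cong:
  assumes "\<And>n. n \<in> {1..m} \<Longrightarrow> L n = L' n"
  shows "tensor_op L m g = tensor_op L' m g"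
  using assms by (induction m arbitrary: g) auto

lemma tensor_op_sum:
  assumes "\<And>n. n \<in> {1..m} \<Longrightarrow> node_op (L n)"
  shows "tensor_op L m (\<lambda>y. \<Sum>i\<in>I. h i y) = (\<Sum>i\<in>I. tensor_op L m (h i))"
  using assms
proof (induction m arbitrary: h)
  case (Suc m)
  then show ?case by (simp add: node_op_sum[OF Suc.prems[of "Suc m"]])
qed simp

text \<open>Multilinearity, expanded one coordinate at a time. For \<open>D = quad_diff N\<close>
  each sum telescopes to the quadrature of level \<open>K\<close>.\<close>

lemma tensor_op_box:
  fixes K :: nat
  assumes D: "\<And>j. node_op (D j)" and sum: "node_op (\<lambda>v. \<Sum>j\<le>K. D j v)"
  shows "tensor_op (\<lambda>_ v. \<Sum>j\<le>K. D j v) m g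
    = (\<Sum>\<alpha>\<in>Pi\<^sub>E {1..m} (\<lambda>_. {..K}). tensor_op (\<lambda>n. D (\<alpha> n)) m g)"
proof (induction m arbitrary: g)
  case (Suc m)
  have "tensor_op (\<lambda>_ v. \<Sum>j\<le>K. D j v) (Suc m) g
      = (\<Sum>j\<le>K. tensor_op (\<lambda>_ v. \<Sum>j\<le>K. D j v) m (\<lambda>y. D j (\<lambda>t. g (y(Suc m := t)))))"
    by (simp add: tensor_op_sum[OF sum])
  also have "\<dots> = (\<Sum>j\<le>K. \<Sum>\<alpha>\<in>Pi\<^sub>E {1..m} (\<lambda>_. {..K}).
      tensor_op (\<lambda>n. D (\<alpha> n)) m (\<lambda>y. D j (\<lambda>t. g (y(Suc m := t)))))"
    by (simp add: Suc.IH)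
  also have "\<dots> = (\<Sum>j\<le>K. \<Sum>\<alpha>\<in>Pi\<^sub>E {1..m} (\<lambda>_. {..K}).
      tensor_op (\<lambda>n. D ((\<alpha>(Suc m := j)) n)) (Suc m) g)"
    by (intro sum.cong refl) (auto intro!: tensor_op_cong)
  also have "\<dots> = (\<Sum>(j, \<alpha>)\<in>{..K} \<times> Pi\<^sub>E {1..m} (\<lambda>_. {..K}).
      tensor_op (\<lambda>n. D ((\<alpha>(Suc m := j)) n)) (Suc m) g)"
    by (rule sum.cartesian_product)
  also have "\<dots> = (\<Sum>\<alpha>\<in>(\<lambda>(j, \<alpha>). \<alpha>(Suc m := j)) ` ({..K} \<times> Pi\<^sub>E {1..m} (\<lambda>_. {..K})).
      tensor_op (\<lambda>n. D (\<alpha> n)) (Suc m) g)"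
  proof -
    have "inj_on (\<lambda>(j, \<alpha>). \<alpha>(Suc m := j)) ({..K} \<times> Pi\<^sub>E {1..m} (\<lambda>_. {..K}))"
      by (rule inj_combinator) simp
    then show ?thesis by (subst sum.reindex) (auto simp: o_def split_def)
  qed
  also have "(\<lambda>(j, \<alpha>). \<alpha>(Suc m := j)) ` ({..K} \<times> Pi\<^sub>E {1..m} (\<lambda>_. {..K})) = Pi\<^sub>E {1..Suc m} (\<lambda>_. {..K})"
    by (simp add: PiE_insert_eq atLeastAtMostSuc_conv)
  finally show ?case .
qed simp

lemma sum_quad_diff: "(\<Sum>j\<le>K. quad_diff N j v) = gauss_quad (N K) v"
  by (induction K) (simp_all add: quad_diff_def)

subsection \<open>The integral as a limit of tensor product quadratures\<close>

text \<open>A separately continuous function is the pointwise limit of functions obtained by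
  rounding the last variable down to a grid of mesh \<open>1 / (k + 1)\<close>: for each of the
  countably many grid values the induction hypothesis applies.\<close>

lemma borel_measurable_sep_continuous:
  fixes g :: "(nat \<Rightarrow> real) \<Rightarrow> real"
  assumes "\<And>y n. y \<in> Pi\<^sub>E {1..m} (\<lambda>_. \<Gamma>) \<Longrightarrow> n \<in> {1..m} \<Longrightarrow> continuous_on \<Gamma> (\<lambda>t. g (y(n := t)))"
  shows "g \<in> borel_measurable (Pi\<^sub>M {1..m} (\<lambda>_. \<Gamma>_measure))"
  using assms
proof (induction m arbitrary: g)
  case 0
  have "g \<in> borel_measurable (count_space {\<lambda>k. undefined})" by simp
  then show ?case by (simp add: PiM_empty)
next
  case (Suc m)
  let ?M = "Pi\<^sub>M {1..Suc m} (\<lambda>_. \<Gamma>_measure)"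
  define I where "I = (\<lambda>k::nat. {i::int. of_int i / real (Suc k) \<in> \<Gamma>})"
  define f where "f = (\<lambda>k i y. if i \<in> I k then g (y(Suc m := of_int i / real (Suc k))) else 0)"
  have f: "f k i \<in> borel_measurable ?M" for k i
  proof (cases "i \<in> I k")
    case True
    define c where "c = of_int i / real (Suc k)"
    have c: "c \<in> \<Gamma>" using True by (simp add: I_def c_def)
    have "(\<lambda>y. g (y(Suc m := c))) \<in> borel_measurable (Pi\<^sub>M {1..m} (\<lambda>_. \<Gamma>_measure))"
    proof (rule Suc.IH)
      fix y n assume y: "y \<in> Pi\<^sub>E {1..m} (\<lambda>_. \<Gamma>)" and n: "n \<in> {1..m}"
      have "continuous_on \<Gamma> (\<lambda>t. g ((y(Suc m := c))(n := t)))"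
        using PiE_Suc_upd[OF y, of c] c n by (intro Suc.prems) auto
      then show "continuous_on \<Gamma> (\<lambda>t. g ((y(n := t))(Suc m := c)))"
        using n by (simp add: fun_upd_twist)
    qed
    moreover have "(\<lambda>y. restrict y {1..m}) \<in> measurable ?M (Pi\<^sub>M {1..m} (\<lambda>_. \<Gamma>_measure))"
      by (rule measurable_restrict_subset) auto
    ultimately have "(\<lambda>y. g ((restrict y {1..m})(Suc m := c))) \<in> borel_measurable ?M"
      by (rule measurable_compose[rotated])
    then show ?thesis
    proof (rule measurable_cong[THEN iffD1, rotated])
      fix y assume "y \<in> space ?M"
      then have "(restrict y {1..m})(Suc m := c) = y(Suc m := c)"
        by (auto simp: space_PiM fun_eq_iff PiE_def extensional_def)
      then show "g ((restrict y {1..m})(Suc m := c)) = f k i y"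
        using True by (simp add: f_def c_def)
    qed
  qed (simp add: f_def)
  show ?case
  proof (rule borel_measurable_LIMSEQ_real)
    have comp: "(\<lambda>y. y (Suc m)) \<in> borel_measurable ?M"
    proof -
      have "(\<lambda>y. y (Suc m)) \<in> measurable ?M \<Gamma>_measure"
        by (rule measurable_component_singleton) simp
      moreover have "(\<lambda>t. t) \<in> borel_measurable \<Gamma>_measure"
        by (rule borel_measurable_Gamma_continuous) simp
      ultimately show ?thesis by (rule measurable_compose)
    qed
    show "(\<lambda>y. f k \<lfloor>y (Suc m) * real (Suc k)\<rfloor> y) \<in> borel_measurable ?M" for k
    proof (rule measurable_compose_countable[OF f])
      show "(\<lambda>y. \<lfloor>y (Suc m) * real (Suc k)\<rfloor>) \<in> measurable ?M (count_space UNIV)"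
        using comp by measurable
    qed
  next
    fix y assume "y \<in> space ?M"
    then have y: "y \<in> Pi\<^sub>E {1..Suc m} (\<lambda>_. \<Gamma>)" by (simp add: space_PiM)
    define t where "t = y (Suc m)"
    define s where "s = (\<lambda>k. of_int \<lfloor>t * real (Suc k)\<rfloor> / real (Suc k))"
    have t: "t \<in> \<Gamma>" using y by (auto simp: t_def PiE_iff)
    \<comment> \<open>Rounding down stays in \<open>\<Gamma>\<close> because -1 is itself a grid
      value.\<close>
    have s_bounds: "t - 1 / real (Suc k) \<le> s k" "s k \<le> t" "s k \<in> \<Gamma>" for k
    proof -
      define c where "c = real (Suc k)"
      have c: "c > 0" by (simp add: c_def)
      have "t * c - 1 \<le> of_int \<lfloor>t * c\<rfloor>" by linarith
      then have "(t * c - 1) / c \<le> of_int \<lfloor>t * c\<rfloor> / c"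
        using c by (intro divide_right_mono) auto
      then show "t - 1 / real (Suc k) \<le> s k"
        using c unfolding s_def c_def[symmetric] by (simp add: diff_divide_distrib)
      show "s k \<le> t"
        using c unfolding s_def c_def[symmetric] by (simp add: divide_le_eq)
      have "- int (Suc k) \<le> \<lfloor>t * real (Suc k)\<rfloor>"
        using t mult_right_mono[of "-1" t "real (Suc k)"] by (simp add: le_floor_iff)
      then have "- real (Suc k) \<le> of_int \<lfloor>t * real (Suc k)\<rfloor>" by linarith
      then have "-1 \<le> s k" by (simp add: s_def field_simps)
      then show "s k \<in> \<Gamma>" using \<open>s k \<le> t\<close> t by auto
    qed
    have lim: "s \<longlonglongrightarrow> t"
    proof (rule real_tendsto_sandwich)
      have "(\<lambda>k. t - 1 / real (Suc k)) \<longlonglongrightarrow> t - 0"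
        by (intro tendsto_intros LIMSEQ_Suc[OF lim_1_over_n])
      then show "(\<lambda>k. t - 1 / real (Suc k)) \<longlonglongrightarrow> t" by simp
    qed (use s_bounds in auto)
    have cont: "continuous_on \<Gamma> (\<lambda>t. g (y(Suc m := t)))"
      by (rule Suc.prems[OF y]) simp
    have "(\<lambda>k. g (y(Suc m := s k))) \<longlonglongrightarrow> g (y(Suc m := t))"
      by (rule continuous_on_tendsto_compose[OF cont lim t]) (use s_bounds(3) in auto)
    moreover have "f k \<lfloor>y (Suc m) * real (Suc k)\<rfloor> y = g (y(Suc m := s k))" for k
      using s_bounds(3)[of k] by (simp add: f_def I_def s_def t_def)
    moreover have "y(Suc m := t) = y" by (simp add: t_def)
    ultimately show "(\<lambda>k. f k \<lfloor>y (Suc m) * real (Suc k)\<rfloor> y) \<longlonglongrightarrow> g y"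
      by simp
  qed
qed

lemma continuous_on_sep_analytic:
  assumes ext: "sep_analytic_ext m S G g" and S: "\<And>n. n \<in> {1..m} \<Longrightarrow> complex_of_real ` \<Gamma> \<subseteq> S n"
    and y: "y \<in> Pi\<^sub>E {1..m} (\<lambda>_. \<Gamma>)" and n: "n \<in> {1..m}"
  shows "continuous_on \<Gamma> (\<lambda>t. g (y(n := t)))"
proof -
  define z where "z = (\<lambda>i\<in>{1..m}. complex_of_real (y i))"
  have "z \<in> Pi\<^sub>E {1..m} S" using y S by (fastforce simp: z_def)
  then have "(\<lambda>x. G (z(n := x))) analytic_on S n"
    using n by (rule sep_analytic_ext_slice[OF ext])
  then have "continuous_on (S n) (\<lambda>x. G (z(n := x)))"
    by (intro holomorphic_on_imp_continuous_on analytic_imp_holomorphic)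
  then have "continuous_on \<Gamma> (\<lambda>t. G (z(n := of_real t)))"
    by (rule continuous_on_compose2[OF _ continuous_on_of_real_id S[OF n]])
  then have cont: "continuous_on \<Gamma> (\<lambda>t. Re (G (z(n := of_real t))))"
    by (rule continuous_on_Re)
  have "Re (G (z(n := of_real t))) = g (y(n := t))" if "t \<in> \<Gamma>" for t
  proof -
    have "z(n := of_real t) = (\<lambda>i\<in>{1..m}. complex_of_real ((y(n := t)) i))"
      using n by (auto simp: z_def fun_eq_iff)
    moreover have "y(n := t) \<in> Pi\<^sub>E {1..m} (\<lambda>_. \<Gamma>)" using y n that by (auto simp: PiE_iff extensional_def)
    ultimately have "G (z(n := of_real t)) = of_real (g (y(n := t)))"
      using sep_analytic_ext_real[OF ext] by metis
    then show ?thesis by simp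
  qed
  then show ?thesis using continuous_on_cong[THEN iffD1, OF refl _ cont] by simp
qed

lemma abs_sep_analytic_le:
  assumes ext: "sep_analytic_ext m S G g" and S: "\<And>n. n \<in> {1..m} \<Longrightarrow> complex_of_real ` \<Gamma> \<subseteq> S n"
    and M: "\<And>z. z \<in> Pi\<^sub>E {1..m} S \<Longrightarrow> cmod (G z) \<le> M" and y: "y \<in> Pi\<^sub>E {1..m} (\<lambda>_. \<Gamma>)"
  shows "\<bar>g y\<bar> \<le> M"
proof -
  have "(\<lambda>i\<in>{1..m}. complex_of_real (y i)) \<in> Pi\<^sub>E {1..m} S" using y S by fastforce
  from M[OF this] show ?thesis using ext y by (simp add: sep_analytic_ext_def)
qed

interpretation Gamma_product: product_sigma_finite "\<lambda>_::nat. \<Gamma>_measure"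
  by unfold_locales

lemma integrable_sep_analytic:
  assumes ext: "sep_analytic_ext m S G g" and S: "\<And>n. n \<in> {1..m} \<Longrightarrow> complex_of_real ` \<Gamma> \<subseteq> S n"
    and M: "\<And>z. z \<in> Pi\<^sub>E {1..m} S \<Longrightarrow> cmod (G z) \<le> M"
  shows "integrable (Pi\<^sub>M {1..m} (\<lambda>_. \<Gamma>_measure)) g"
proof -
  interpret prob_space "Pi\<^sub>M {1..m} (\<lambda>_. \<Gamma>_measure)"
    by (rule prob_space_PiM) (rule prob_space_Gamma_measure)
  show ?thesis
  proof (rule integrable_const_bound[OF AE_I2])
    show "g \<in> borel_measurable (Pi\<^sub>M {1..m} (\<lambda>_. \<Gamma>_measure))"
      by (rule borel_measurable_sep_continuous) (rule continuous_on_sep_analytic[OF ext S])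
    show "norm (g y) \<le> M" if "y \<in> space (Pi\<^sub>M {1..m} (\<lambda>_. \<Gamma>_measure))" for y
      using abs_sep_analytic_le[OF ext S M] that by (simp add: space_PiM)
  qed
qed

lemma integral_op_bound:
  assumes "integrable (Pi\<^sub>M {1..m} (\<lambda>_. \<Gamma>_measure)) h"
    and "\<And>y. y \<in> Pi\<^sub>E {1..m} (\<lambda>_. \<Gamma>) \<Longrightarrow> \<bar>h y\<bar> \<le> B"
  shows "\<bar>integral_op m h\<bar> \<le> B"
proof -
  interpret prob_space "Pi\<^sub>M {1..m} (\<lambda>_. \<Gamma>_measure)"
    by (rule prob_space_PiM) (rule prob_space_Gamma_measure)
  have "\<bar>integral_op m h\<bar> \<le> (LINT y | Pi\<^sub>M {1..m} (\<lambda>_. \<Gamma>_measure). \<bar>h y\<bar>)"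
    unfolding integral_op_def by (rule integral_abs_bound)
  also have "\<dots> \<le> B"
    using assms by (intro integral_le_const AE_I2) (auto simp: space_PiM)
  finally show ?thesis .
qed

text \<open>The integral is exchanged for the quadrature one variable at a time, starting with the
  last. Since the quadrature has norm 1, the bound \<open>M\<close> is preserved and the univariate
  errors simply add.\<close>

lemma integral_tensor_error:
  assumes L: "node_op L" and bound: "\<And>n. n \<in> {1..m} \<Longrightarrow> op_bound (S n) L 1"
    and S: "\<And>n. n \<in> {1..m} \<Longrightarrow> complex_of_real ` \<Gamma> \<subseteq> S n"
    and err: "\<And>n V v M. n \<in> {1..m} \<Longrightarrow> V analytic_on S n \<Longrightarrow> (\<And>z. z \<in> S n \<Longrightarrow> cmod (V z) \<le> M) \<Longrightarrow>
       (\<And>t. t \<in> \<Gamma> \<Longrightarrow> V (of_real t) = of_real (v t)) \<Longrightarrow> \<bar>(LINT t | \<Gamma>_measure. v t) - L v\<bar> \<le> \<epsilon> n * M"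
    and ext: "sep_analytic_ext m S G g"
    and M: "\<And>z. z \<in> Pi\<^sub>E {1..m} S \<Longrightarrow> cmod (G z) \<le> M"
  shows "\<bar>integral_op m g - tensor_op (\<lambda>_. L) m g\<bar> \<le> (\<Sum>n=1..m. \<epsilon> n) * M"
  using assms
proof (induction m arbitrary: G g)
  case 0
  show ?case by (simp add: integral_op_def PiM_empty lebesgue_integral_count_space_finite)
next
  case (Suc m)
  have S: "complex_of_real ` \<Gamma> \<subseteq> S n" if "n \<in> {1..Suc m}" for n using Suc.prems(3) that .
  note ext = Suc.prems(5)
  have M: "cmod (G z) \<le> M" if "z \<in> Pi\<^sub>E {1..Suc m} S" for z using Suc.prems(6) that .
  define g' where "g' = (\<lambda>y. L (\<lambda>t. g (y(Suc m := t))))"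
  define G' where "G' = (\<lambda>z. complexify L (\<lambda>t. G (z(Suc m := t))))"
  define h where "h = (\<lambda>y. LINT t | \<Gamma>_measure. g (y(Suc m := t)))"
  let ?P = "Pi\<^sub>M {1..m} (\<lambda>_. \<Gamma>_measure)"
  have ext': "sep_analytic_ext m S G' g'"
    unfolding G'_def g'_def by (rule sep_analytic_ext_step[OF ext \<open>node_op L\<close> S]) simp
  have M': "cmod (G' z) \<le> M" if "z \<in> Pi\<^sub>E {1..m} S" for z
  proof -
    have "cmod (G' z) \<le> 1 * M"
      unfolding G'_def by (rule op_bound_step[OF ext Suc.prems(2) S M that]) auto
    then show ?thesis by simp
  qed
  have IH: "\<bar>integral_op m g' - tensor_op (\<lambda>_. L) m g'\<bar> \<le> (\<Sum>n=1..m. \<epsilon> n) * M"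
  proof (rule Suc.IH[OF \<open>node_op L\<close> _ _ _ ext' M'])
    fix n V v M
    assume "n \<in> {1..m}" "V analytic_on S n" "\<And>z. z \<in> S n \<Longrightarrow> cmod (V z) \<le> M"
       "\<And>t. t \<in> \<Gamma> \<Longrightarrow> V (of_real t) = of_real (v t)"
    then show "\<bar>(LINT t | \<Gamma>_measure. v t) - L v\<bar> \<le> \<epsilon> n * M"
      by (intro Suc.prems(4)) auto
  qed (use Suc.prems(2) S in auto)
  have int_g: "integrable (Pi\<^sub>M (insert (Suc m) {1..m}) (\<lambda>_. \<Gamma>_measure)) g"
    using integrable_sep_analytic[OF ext S M] by (simp add: atLeastAtMostSuc_conv)
  have int_g': "integrable ?P g'"
    by (rule integrable_sep_analytic[OF ext' S M']) auto
  have slice: "\<bar>h y - g' y\<bar> \<le> \<epsilon> (Suc m) * M" if y: "y \<in> Pi\<^sub>E {1..m} (\<lambda>_. \<Gamma>)" for y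
  proof -
    define z where "z = (\<lambda>i\<in>{1..m}. complex_of_real (y i))"
    have z: "z \<in> Pi\<^sub>E {1..m} S"
    proof (unfold z_def, rule restrict_PiE_iff[THEN iffD2], rule ballI)
      fix i assume i: "i \<in> {1..m}"
      then have "y i \<in> \<Gamma>" using y by (auto simp: PiE_iff)
      then show "complex_of_real (y i) \<in> S i" using S[of i] i by auto
    qed
    have "(\<lambda>t. G (z(Suc m := t))) analytic_on S (Suc m)"
      using S by (intro sep_analytic_ext_last[OF ext _ z]) auto
    moreover have "G (z(Suc m := of_real t)) = of_real (g (y(Suc m := t)))" if "t \<in> \<Gamma>" for t
      unfolding z_def restrict_of_real_upd
      by (rule sep_analytic_ext_real[OF ext PiE_Suc_upd[OF y that]])
    ultimately show ?thesis
      unfolding h_def g'_def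
      by (intro Suc.prems(4)[where V = "\<lambda>t. G (z(Suc m := t))"]) (use M PiE_Suc_upd[OF z] in auto)
  qed
  \<comment> \<open>Joint measurability makes the inner integral \<open>h\<close> measurable;
    boundedness follows by comparison with \<open>g'\<close>.\<close>
  have int_h: "integrable ?P h"
  proof -
    interpret prob_space ?P
      by (rule prob_space_PiM) (rule prob_space_Gamma_measure)
    have "(\<lambda>(y, t). g (y(Suc m := t))) \<in> borel_measurable (?P \<Otimes>\<^sub>M \<Gamma>_measure)"
      using measurable_compose[OF measurable_add_dim borel_measurable_integrable[OF int_g]]
      by (simp add: split_def)
    then have meas: "h \<in> borel_measurable ?P"
      unfolding h_def by (rule Gamma_measure.borel_measurable_lebesgue_integral)
    show ?thesis
    proof (rule integrable_const_bound[OF AE_I2 meas])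
      fix y assume "y \<in> space ?P"
      then have y: "y \<in> Pi\<^sub>E {1..m} (\<lambda>_. \<Gamma>)" by (simp add: space_PiM)
      then have "\<bar>g' y\<bar> \<le> M" by (rule abs_sep_analytic_le[OF ext' S M', rotated 2]) auto
      then show "norm (h y) \<le> M + \<epsilon> (Suc m) * M" using slice[OF y] by simp
    qed
  qed
  have "integral_op (Suc m) g = integral_op m h"
    unfolding integral_op_def h_def
    using Gamma_product.product_integral_insert[OF _ _ int_g] by (simp add: atLeastAtMostSuc_conv)
  moreover have "\<bar>integral_op m h - integral_op m g'\<bar> \<le> \<epsilon> (Suc m) * M"
  proof -
    have "integral_op m h - integral_op m g' = integral_op m (\<lambda>y. h y - g' y)"
      unfolding integral_op_def using int_h int_g' by simp
    also have "\<bar>\<dots>\<bar> \<le> \<epsilon> (Suc m) * M"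
      using int_h int_g' slice by (intro integral_op_bound) auto
    finally show ?thesis .
  qed
  moreover have "tensor_op (\<lambda>_. L) (Suc m) g = tensor_op (\<lambda>_. L) m g'"
    by (simp add: g'_def)
  ultimately show ?case
    using IH by (simp add: distrib_right)
qed

subsection \<open>Univariate error bounds\<close>

lemma complexify_gauss_quad:
  "complexify (gauss_quad n) V = (\<Sum>x\<in>gauss_points n. of_real (gauss_weight n x) * V (of_real x))"
  by (rule complexify_sum) (simp_all add: gauss_quad_def)

text \<open>The weights are nonnegative with sum 1, so the value is an average of values of
  \<open>V\<close>.\<close>

lemma norm_complexify_gauss_quad_le:
  assumes "n > 0" "\<And>x. x \<in> \<Gamma> \<Longrightarrow> cmod (V (of_real x)) \<le> e"
  shows "cmod (complexify (gauss_quad n) V) \<le> e"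
proof -
  have "cmod (complexify (gauss_quad n) V) \<le> (\<Sum>x\<in>gauss_points n. gauss_weight n x * e)"
    unfolding complexify_gauss_quad
    by (rule sum_norm_le)
       (use assms(2) gauss_points_eq(2)[of n] in
         \<open>auto simp: norm_mult gauss_weight_nonneg intro!: mult_left_mono\<close>)
  also have "\<dots> = e"
    using sum_gauss_weight[OF assms(1)] by (simp flip: sum_distrib_right)
  finally show ?thesis .
qed

lemma abs_gauss_quad_le:
  assumes "n > 0" "\<And>x. x \<in> \<Gamma> \<Longrightarrow> \<bar>v x\<bar> \<le> e"
  shows "\<bar>gauss_quad n v\<bar> \<le> e"
proof -
  have "complexify (gauss_quad n) (\<lambda>z. of_real (v (Re z))) = of_real (gauss_quad n v)"
    by (simp add: complexify_gauss_quad gauss_quad_def)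
  then show ?thesis
    using norm_complexify_gauss_quad_le[OF assms(1), of "\<lambda>z. of_real (v (Re z))" e] assms(2) by simp
qed

lemma gauss_quad_diff: "gauss_quad n (\<lambda>t. v t - u t) = gauss_quad n v - gauss_quad n u"
  by (simp add: gauss_quad_def right_diff_distrib sum_subtractf)

lemma complexify_gauss_quad_diff:
  "complexify (gauss_quad n) (\<lambda>z. V z - W z) = complexify (gauss_quad n) V - complexify (gauss_quad n) W"
  by (simp add: complexify_gauss_quad right_diff_distrib sum_subtractf)

lemma poly_map_poly_Re: "poly (map_poly Re P) t = Re (poly P (of_real t))"
  by (induction P) (simp_all add: map_poly_pCons)

lemma poly_map_poly_Im: "poly (map_poly Im P) t = Im (poly P (of_real t))"
  by (induction P) (simp_all add: map_poly_pCons)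

text \<open>The right-hand side does not mention \<open>n\<close>; two rules that are both exact on
  \<open>P\<close> therefore cancel in a difference.\<close>

lemma complexify_gauss_quad_poly:
  assumes "degree P < 2 * n"
  shows "complexify (gauss_quad n) (poly P)
    = Complex (LINT t | \<Gamma>_measure. poly (map_poly Re P) t) (LINT t | \<Gamma>_measure. poly (map_poly Im P) t)"
proof -
  have "degree (map_poly Re P) < 2 * n" "degree (map_poly Im P) < 2 * n"
    using assms map_poly_degree_leq[of Re P] map_poly_degree_leq[of Im P] by linarith+
  then show ?thesis
    unfolding complexify_def poly_map_poly_Re[symmetric] poly_map_poly_Im[symmetric]
    by (simp add: gauss_quad_exact)
qed

lemma op_bound_gauss_quad:
  assumes "n > 0" "complex_of_real ` \<Gamma> \<subseteq> S"
  shows "op_bound S (gauss_quad n) 1"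
  unfolding op_bound_def using assms by (auto intro!: norm_complexify_gauss_quad_le)

context bernstein_ellipse
begin

abbreviation approx_const :: real where
  "approx_const \<equiv> 4 / (1 - 1 / \<kappa>) ^ 3"

lemma op_bound_quad_diff:
  assumes N: "\<And>j. j + 2 \<le> 2 * N j" and j: "j > 0"
  shows "op_bound (\<Sigma>_nbhd \<tau>) (quad_diff N j) (2 * approx_const * (1 / \<kappa>) ^ j)"
  unfolding op_bound_def
proof (intro allI impI, elim conjE)
  fix V M assume V: "V analytic_on \<Sigma>_nbhd \<tau>" and M: "\<forall>z\<in>\<Sigma>_nbhd \<tau>. cmod (V z) \<le> M"
  let ?e = "approx_const * (1 / \<kappa>) ^ j * M"
  obtain P where P: "degree P \<le> j" "\<And>x. x \<in> \<Gamma> \<Longrightarrow> cmod (V (of_real x) - poly P (of_real x)) \<le> ?e"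
    using chebyshev_approximation[OF analytic_imp_holomorphic[OF V], of M j] M by blast
  let ?Q = "\<lambda>i. complexify (gauss_quad (N i))"
  \<comment> \<open>For \<open>j > 0\<close>, the hypothesis at \<open>j - 1\<close> reads
    \<open>j + 1 \<le> 2 * N (j - 1)\<close>, exactly what exactness of the lower rule in degree
    \<open>j\<close> requires.\<close>
  have "2 \<le> 2 * N j" "j + 1 \<le> 2 * N (j - 1)" "2 \<le> 2 * N (j - 1)"
    using N[of j] N[of "j - 1"] j by linarith+
  then have N': "0 < N j" "0 < N (j - 1)" "degree P < 2 * N j" "degree P < 2 * N (j - 1)"
    using N[of j] P(1) by linarith+
  have "complexify (quad_diff N j) V = ?Q j V - ?Q (j - 1) V"
    using j by (simp add: complexify_def quad_diff_def complex_eq_iff)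
  also have "\<dots> = ?Q j (\<lambda>z. V z - poly P z) - ?Q (j - 1) (\<lambda>z. V z - poly P z)"
    unfolding complexify_gauss_quad_diff using N' by (simp add: complexify_gauss_quad_poly)
  also have "cmod \<dots> \<le> ?e + ?e"
    by (intro order.trans[OF norm_triangle_ineq4] add_mono norm_complexify_gauss_quad_le N' P)
  finally show "cmod (complexify (quad_diff N j) V) \<le> 2 * approx_const * (1 / \<kappa>) ^ j * M"
    by (simp add: mult_ac)
qed

text \<open>On \<open>\<Gamma>\<close> the real part of the approximant is a real polynomial at
  least as close to the real function \<open>v\<close>. Integral and quadrature agree on it, and
  each contributes one approximation error.\<close>

lemma gauss_quad_error:
  assumes k: "k < 2 * n" and V: "V analytic_on \<Sigma>_nbhd \<tau>"
    and M: "\<And>z. z \<in> \<Sigma>_nbhd \<tau> \<Longrightarrow> cmod (V z) \<le> M"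
    and v: "\<And>t. t \<in> \<Gamma> \<Longrightarrow> V (of_real t) = of_real (v t)"
  shows "\<bar>(LINT t | \<Gamma>_measure. v t) - gauss_quad n v\<bar> \<le> 2 * approx_const * (1 / \<kappa>) ^ k * M"
proof -
  let ?e = "approx_const * (1 / \<kappa>) ^ k * M"
  obtain P where P: "degree P \<le> k" "\<And>x. x \<in> \<Gamma> \<Longrightarrow> cmod (V (of_real x) - poly P (of_real x)) \<le> ?e"
    using chebyshev_approximation[OF analytic_imp_holomorphic[OF V], of M k] M by blast
  define p where "p = map_poly Re P"
  have n: "n > 0" using k by simp
  have "degree p < 2 * n"
    using P(1) k map_poly_degree_leq[of Re P] by (simp add: p_def)
  then have exact: "gauss_quad n (poly p) = (LINT t | \<Gamma>_measure. poly p t)"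
    by (rule gauss_quad_exact)
  have e: "\<bar>v t - poly p t\<bar> \<le> ?e" if t: "t \<in> \<Gamma>" for t
  proof -
    have "v t - poly p t = Re (V (of_real t) - poly P (of_real t))"
      by (simp add: v[OF t] p_def poly_map_poly_Re)
    then show ?thesis using abs_Re_le_cmod P(2)[OF t] order.trans by metis
  qed
  have "continuous_on (\<Sigma>_nbhd \<tau>) V"
    by (intro holomorphic_on_imp_continuous_on analytic_imp_holomorphic V)
  then have "continuous_on \<Gamma> (\<lambda>t. V (of_real t))"
    by (rule continuous_on_compose2[OF _ continuous_on_of_real_id])
       (use tau_pos in \<open>auto intro: of_real_in_Sigma_nbhd\<close>)
  then have "continuous_on \<Gamma> (\<lambda>t. Re (V (of_real t)))" by (rule continuous_on_Re)
  then have cont: "continuous_on \<Gamma> v"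
    by (rule continuous_on_cong[THEN iffD1, OF refl, rotated]) (simp add: v)
  then have int: "integrable \<Gamma>_measure v" "integrable \<Gamma>_measure (\<lambda>t. v t - poly p t)"
    by (auto intro!: integrable_Gamma_continuous continuous_intros)
  have "(LINT t | \<Gamma>_measure. v t) - gauss_quad n v
      = (LINT t | \<Gamma>_measure. v t - poly p t) - gauss_quad n (\<lambda>t. v t - poly p t)"
    by (simp add: int gauss_quad_diff exact)
  moreover have "\<bar>LINT t | \<Gamma>_measure. v t - poly p t\<bar> \<le> ?e"
  proof -
    have "\<bar>LINT t | \<Gamma>_measure. v t - poly p t\<bar> \<le> (LINT t | \<Gamma>_measure. \<bar>v t - poly p t\<bar>)"
      by (rule integral_abs_bound)
    also have "\<dots> \<le> ?e"
      using int e by (intro Gamma_measure.integral_le_const AE_I2) auto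
    finally show ?thesis .
  qed
  moreover have "\<bar>gauss_quad n (\<lambda>t. v t - poly p t)\<bar> \<le> ?e"
    by (rule abs_gauss_quad_le[OF n e])
  ultimately show ?thesis by linarith
qed

end

subsection \<open>Consequences of joint analyticity\<close>

text \<open>Unconditional summability over the multi-indices is absolute, so the series at the
  single point with all increments equal to \<open>\<rho> / 2\<close> majorises the series on the
  whole polydisc of that radius.\<close>

lemma multi_analytic_locally_bounded:
  assumes J: "finite J" and an: "multi_analytic_on J g S" and z: "z \<in> S"
  shows "\<exists>\<rho>>0. \<exists>B. \<forall>x\<in>Pi\<^sub>E J (\<lambda>j. ball (z j) \<rho>). cmod (g x) \<le> B"
proof -
  obtain \<rho> a where \<rho>: "\<rho> > 0" and sum: "\<And>h. h \<in> J \<rightarrow>\<^sub>E ball 0 \<rho> \<Longrightarrow>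
      ((\<lambda>\<alpha>. a \<alpha> * (\<Prod>j\<in>J. h j ^ \<alpha> j)) has_sum g (\<lambda>j\<in>J. z j + h j)) (J \<rightarrow>\<^sub>E UNIV)"
    using an z unfolding multi_analytic_on_def by meson
  define r where "r = \<rho> / 2"
  have r: "r > 0" "r < \<rho>" using \<rho> by (auto simp: r_def)
  define B where "B = (\<Sum>\<^sub>\<infinity>\<alpha>\<in>J \<rightarrow>\<^sub>E UNIV. cmod (a \<alpha> * (\<Prod>j\<in>J. complex_of_real r ^ \<alpha> j)))"
  have "(\<lambda>j\<in>J. complex_of_real r) \<in> J \<rightarrow>\<^sub>E ball 0 \<rho>" using r by (auto simp: dist_norm)
  from sum[OF this] have "((\<lambda>\<alpha>. a \<alpha> * (\<Prod>j\<in>J. complex_of_real r ^ \<alpha> j)) has_sum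
      g (\<lambda>j\<in>J. z j + (\<lambda>j\<in>J. complex_of_real r) j)) (J \<rightarrow>\<^sub>E UNIV)"
    by (simp cong: prod.cong)
  then have "(\<lambda>\<alpha>. cmod (a \<alpha> * (\<Prod>j\<in>J. complex_of_real r ^ \<alpha> j))) summable_on (J \<rightarrow>\<^sub>E UNIV)"
    by (rule summable_on_iff_abs_summable_on_complex[THEN iffD1, OF has_sum_imp_summable])
  then have B: "((\<lambda>\<alpha>. cmod (a \<alpha> * (\<Prod>j\<in>J. complex_of_real r ^ \<alpha> j))) has_sum B) (J \<rightarrow>\<^sub>E UNIV)"
    unfolding B_def by (rule has_sum_infsum)
  have "cmod (g x) \<le> B" if x: "x \<in> Pi\<^sub>E J (\<lambda>j. ball (z j) r)" for x
  proof -
    define h where "h = (\<lambda>j\<in>J. x j - z j)"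
    have h: "cmod (h j) < r" if "j \<in> J" for j
      using PiE_mem[OF x that] that by (simp add: h_def dist_norm norm_minus_commute)
    have "h \<in> J \<rightarrow>\<^sub>E ball 0 \<rho>"
      using r h by (auto simp: h_def intro!: less_trans[of _ r \<rho>])
    from sum[OF this] have "((\<lambda>\<alpha>. a \<alpha> * (\<Prod>j\<in>J. h j ^ \<alpha> j)) has_sum g (\<lambda>j\<in>J. z j + h j))
        (J \<rightarrow>\<^sub>E UNIV)" .
    moreover have "(\<lambda>j\<in>J. z j + h j) = x"
      using x by (auto simp: h_def fun_eq_iff PiE_def extensional_def)
    ultimately have "((\<lambda>\<alpha>. a \<alpha> * (\<Prod>j\<in>J. h j ^ \<alpha> j)) has_sum g x) (J \<rightarrow>\<^sub>E UNIV)" by simp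
    then show ?thesis
    proof (rule norm_infsum_le[OF _ B])
      fix \<alpha> :: "nat \<Rightarrow> nat"
      have "(\<Prod>j\<in>J. cmod (h j) ^ \<alpha> j) \<le> (\<Prod>j\<in>J. r ^ \<alpha> j)"
        using h by (intro prod_mono conjI power_mono) (auto simp: less_imp_le)
      then show "cmod (a \<alpha> * (\<Prod>j\<in>J. h j ^ \<alpha> j)) \<le> cmod (a \<alpha> * (\<Prod>j\<in>J. complex_of_real r ^ \<alpha> j))"
        using r by (simp add: norm_mult norm_power mult_left_mono flip: prod_norm)
    qed
  qed
  then show ?thesis using r(1) by blast
qed

text \<open>Finitely many of the polydiscs of \<open>multi_analytic_locally_bounded\<close> cover
  the compact product. Boundedness is what makes the supremum in \<open>\<Sigma>_norm\<close> an
  actual upper bound.\<close>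

lemma multi_analytic_bounded:
  assumes J: "finite J" and K: "\<And>j. j \<in> J \<Longrightarrow> compact (K j)"
    and an: "multi_analytic_on J g (Pi\<^sub>E J K)"
  shows "\<exists>B. \<forall>x\<in>Pi\<^sub>E J K. cmod (g x) \<le> B"
proof -
  let ?X = "product_topology (\<lambda>_. euclidean) J :: (nat \<Rightarrow> complex) topology"
  define U where "U = {Pi\<^sub>E J (\<lambda>j. ball (z j) \<rho>) | z \<rho>. z \<in> Pi\<^sub>E J K \<and> \<rho> > 0 \<and>
      (\<exists>B. \<forall>x\<in>Pi\<^sub>E J (\<lambda>j. ball (z j) \<rho>). cmod (g x) \<le> B)}"
  have "compactin ?X (Pi\<^sub>E J K)"
    using K by (simp add: compactin_PiE)
  moreover have "openin ?X V" if "V \<in> U" for V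
    using that J by (auto simp: U_def openin_PiE_gen)
  moreover have "Pi\<^sub>E J K \<subseteq> \<Union>U"
  proof
    fix z assume z: "z \<in> Pi\<^sub>E J K"
    obtain \<rho> B where \<rho>: "\<rho> > 0" "\<forall>x\<in>Pi\<^sub>E J (\<lambda>j. ball (z j) \<rho>). cmod (g x) \<le> B"
      using multi_analytic_locally_bounded[OF J an z] by blast
    have "z \<in> Pi\<^sub>E J (\<lambda>j. ball (z j) \<rho>)" using z \<rho>(1) by (auto simp: PiE_iff)
    moreover have "Pi\<^sub>E J (\<lambda>j. ball (z j) \<rho>) \<in> U" using z \<rho> unfolding U_def by blast
    ultimately show "z \<in> \<Union>U" by blast
  qed
  ultimately obtain W where W: "finite W" "W \<subseteq> U" "Pi\<^sub>E J K \<subseteq> \<Union>W"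
    using compactinD by metis
  have "\<forall>V\<in>W. \<exists>B. \<forall>x\<in>V. cmod (g x) \<le> B" using W(2) unfolding U_def by blast
  then obtain b where b: "\<And>V x. V \<in> W \<Longrightarrow> x \<in> V \<Longrightarrow> cmod (g x) \<le> b V" by metis
  have "cmod (g x) \<le> (\<Sum>V\<in>W. \<bar>b V\<bar>)" if x: "x \<in> Pi\<^sub>E J K" for x
  proof -
    obtain V where V: "V \<in> W" "x \<in> V" using W x by blast
    have "cmod (g x) \<le> \<bar>b V\<bar>" using b[OF V] by linarith
    also have "\<dots> \<le> (\<Sum>V\<in>W. \<bar>b V\<bar>)" using W V by (intro member_le_sum) auto
    finally show ?thesis .
  qed
  then show ?thesis by blast
qed

text \<open>Multi-indices on a singleton correspond to natural numbers, which turns the expansion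
  into an ordinary power series.\<close>

lemma multi_analytic_singleton:
  assumes an: "multi_analytic_on {n} (\<lambda>x. H (x n)) (Pi\<^sub>E {n} (\<lambda>_. S))"
  shows "H analytic_on S"
  unfolding analytic_on_def
proof
  fix s assume s: "s \<in> S"
  define z where "z = (\<lambda>i\<in>{n}. s)"
  have "z \<in> Pi\<^sub>E {n} (\<lambda>_. S)" using s by (auto simp: z_def)
  then obtain \<rho> a where \<rho>: "\<rho> > 0" and sum: "\<And>h. h \<in> {n} \<rightarrow>\<^sub>E ball 0 \<rho> \<Longrightarrow>
      ((\<lambda>\<alpha>. a \<alpha> * (\<Prod>j\<in>{n}. h j ^ \<alpha> j)) has_sum H ((\<lambda>j\<in>{n}. z j + h j) n)) ({n} \<rightarrow>\<^sub>E UNIV)"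
    using an unfolding multi_analytic_on_def by meson
  define b where "b = (\<lambda>k. a (\<lambda>i\<in>{n}. k))"
  have bij: "bij_betw (\<lambda>k. \<lambda>i\<in>{n}. k) (UNIV :: nat set) ({n} \<rightarrow>\<^sub>E UNIV)"
    by (rule bij_betw_byWitness[where f' = "\<lambda>\<alpha>. \<alpha> n"])
       (auto simp: fun_eq_iff PiE_def extensional_def)
  have "(\<lambda>k. b k * (w - s) ^ k) sums H w" if w: "w \<in> ball s \<rho>" for w
  proof -
    have "(\<lambda>i\<in>{n}. w - s) \<in> {n} \<rightarrow>\<^sub>E ball 0 \<rho>"
      using w by (auto simp: dist_norm norm_minus_commute)
    from sum[OF this] have "((\<lambda>\<alpha>. a \<alpha> * (w - s) ^ \<alpha> n) has_sum H w) ({n} \<rightarrow>\<^sub>E UNIV)"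
      by (simp add: z_def)
    then have "((\<lambda>k. a (\<lambda>i\<in>{n}. k) * (w - s) ^ (\<lambda>i\<in>{n}. k) n) has_sum H w) UNIV"
      using has_sum_reindex_bij_betw[OF bij, of "\<lambda>\<alpha>. a \<alpha> * (w - s) ^ \<alpha> n"] by blast
    then show ?thesis unfolding b_def by (auto dest: has_sum_imp_sums)
  qed
  then have "H holomorphic_on ball s \<rho>" by (rule power_series_holomorphic)
  then show "\<exists>e>0. H holomorphic_on ball s e" using \<rho> by blast
qed

lemma merge_singleton:
  fixes n :: nat
  assumes "n \<ge> 1" "x \<in> Pi\<^sub>E {1..} S"
  shows "merge {n} ({1..} - {n}) (u, x) = x(n := u n)"
  using assms by (auto simp: merge_def fun_eq_iff PiE_def extensional_def)

locale anchored_extension =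
  fixes \<tau> :: "nat \<Rightarrow> real" and f :: "(nat \<Rightarrow> real) \<Rightarrow> real"
    and F :: "(nat \<Rightarrow> complex) \<Rightarrow> complex" and \<psi> :: "nat \<Rightarrow> real" and m :: nat
  assumes ext: "analytic_extension \<tau> f F" and \<psi>: "\<psi> \<in> {1..} \<rightarrow>\<^sub>E \<Gamma>"
    and tau: "\<And>n. n \<ge> 1 \<Longrightarrow> \<tau> n > 0"
begin

abbreviation "G \<equiv> anchored (\<lambda>n. complex_of_real (\<psi> n)) m F"
abbreviation "S \<equiv> \<lambda>n. \<Sigma>_nbhd (\<tau> n)"

lemma merge_anchor:
  assumes "z \<in> Pi\<^sub>E {1..m} S"
  shows "merge {1..m} {m<..} (z, \<lambda>n. complex_of_real (\<psi> n)) \<in> Pi\<^sub>E {1..} S"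
proof (rule PiE_I)
  fix n :: nat assume n: "n \<in> {1..}"
  show "merge {1..m} {m<..} (z, \<lambda>n. complex_of_real (\<psi> n)) n \<in> S n"
  proof (cases "n \<le> m")
    case True
    then show ?thesis using assms n by (auto simp: merge_def PiE_iff)
  next
    case False
    then have "\<psi> n \<in> \<Gamma>" using \<psi> n by (auto simp: PiE_iff)
    then show ?thesis
      using False of_real_in_Sigma_nbhd[of "\<psi> n" "\<tau> n"] tau[of n] n by (simp add: merge_def)
  qed
qed (auto simp: merge_def)

lemma sep_analytic_ext_anchored: "sep_analytic_ext m S G (anchored \<psi> m f)"
  unfolding sep_analytic_ext_def
proof (intro conjI ballI)
  fix z n assume z: "z \<in> Pi\<^sub>E {1..m} S" and n: "n \<in> {1..m}"
  define p where "p = merge {1..m} {m<..} (z, \<lambda>n. complex_of_real (\<psi> n))"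
  have p: "p \<in> Pi\<^sub>E {1..} S" unfolding p_def by (rule merge_anchor[OF z])
  have "multi_analytic_on {n} (\<lambda>x. F (merge {n} ({1..} - {n}) (x, p))) (Pi\<^sub>E {n} S)"
    using ext p n unfolding analytic_extension_def by fastforce
  moreover have "Pi\<^sub>E {n} S = Pi\<^sub>E {n} (\<lambda>_. S n)"
    by (rule PiE_cong) simp
  ultimately have "multi_analytic_on {n} (\<lambda>x. F (p(n := x n))) (Pi\<^sub>E {n} (\<lambda>_. S n))"
    using n merge_singleton[OF _ p] by simp
  then have "(\<lambda>t. F (p(n := t))) analytic_on S n" by (rule multi_analytic_singleton)
  moreover have "G (z(n := t)) = F (p(n := t))" for t
  proof -
    have "merge {1..m} {m<..} (z(n := t), \<lambda>n. complex_of_real (\<psi> n)) = p(n := t)"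
      using n by (auto simp: p_def merge_def fun_eq_iff)
    then show ?thesis by (simp add: anchored_def)
  qed
  ultimately show "(\<lambda>t. G (z(n := t))) analytic_on S n" by simp
next
  fix y assume y: "y \<in> Pi\<^sub>E {1..m} (\<lambda>_. \<Gamma>)"
  define p where "p = merge {1..m} {m<..} (y, \<psi>)"
  have "p \<in> {1..} \<rightarrow>\<^sub>E \<Gamma>"
  proof (rule PiE_I)
    fix n :: nat assume "n \<in> {1..}"
    then show "p n \<in> \<Gamma>"
      using PiE_mem[OF y, of n] PiE_mem[OF \<psi>, of n] by (auto simp: p_def merge_def)
  qed (auto simp: p_def merge_def)
  then have "F (\<lambda>n\<in>{1..}. complex_of_real (p n)) = complex_of_real (f p)"
    using ext unfolding analytic_extension_def by blast
  moreover have "merge {1..m} {m<..} (\<lambda>i\<in>{1..m}. complex_of_real (y i), \<lambda>n. complex_of_real (\<psi> n))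
      = (\<lambda>n\<in>{1..}. complex_of_real (p n))"
    by (auto simp: p_def merge_def fun_eq_iff)
  ultimately show "G (\<lambda>i\<in>{1..m}. complex_of_real (y i)) = complex_of_real (anchored \<psi> m f y)"
    by (simp add: anchored_def p_def)
qed

lemma norm_le_Sigma_norm:
  assumes z: "z \<in> Pi\<^sub>E {1..m} S"
  shows "cmod (G z) \<le> \<Sigma>_norm \<tau> m G"
proof -
  define p where "p = (\<lambda>n\<in>{1..}. complex_of_real (\<psi> n))"
  have p: "p \<in> Pi\<^sub>E {1..} S"
  proof (rule PiE_I)
    fix n :: nat assume n: "n \<in> {1..}"
    then have "\<psi> n \<in> \<Gamma>" using \<psi> by (auto simp: PiE_iff)
    then show "p n \<in> S n"
      using of_real_in_Sigma_nbhd[of "\<psi> n" "\<tau> n"] tau[of n] n by (simp add: p_def)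
  qed (auto simp: p_def)
  have "multi_analytic_on {1..m} (\<lambda>x. F (merge {1..m} ({1..} - {1..m}) (x, p))) (Pi\<^sub>E {1..m} S)"
    using ext p unfolding analytic_extension_def by fastforce
  moreover have "merge {1..m} ({1..} - {1..m}) (x, p)
      = merge {1..m} {m<..} (x, \<lambda>n. complex_of_real (\<psi> n))" for x
    by (auto simp: merge_def p_def fun_eq_iff)
  ultimately have "multi_analytic_on {1..m} G (Pi\<^sub>E {1..m} S)"
    by (simp add: anchored_def)
  then obtain B where "\<And>x. x \<in> Pi\<^sub>E {1..m} S \<Longrightarrow> cmod (G x) \<le> B"
    using multi_analytic_bounded[of "{1..m}" S G] compact_Sigma_nbhd by blast
  then have "bdd_above ((\<lambda>z. cmod (G z)) ` Pi\<^sub>E {1..m} S)" by (auto intro!: bdd_aboveI)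
  then show ?thesis unfolding \<Sigma>_norm_def by (rule cSUP_upper[OF z])
qed

end

subsection \<open>Counting multi-indices and grid points\<close>

lemma sum_power_le:
  fixes x :: real
  assumes "0 \<le> x" "x < 1"
  shows "(\<Sum>j<n. x ^ j) \<le> 1 / (1 - x)"
  using assms by (simp add: sum_gp_strict divide_right_mono)

text \<open>Partial sums of the differentiated geometric series; the induction proves their closed
  form, whose remainder term is nonnegative.\<close>

lemma sum_Suc_power_le:
  fixes x :: real
  assumes "0 \<le> x" "x < 1"
  shows "(\<Sum>j\<le>K. real (Suc j) * x ^ j) \<le> 1 / (1 - x)\<^sup>2"
proof -
  have eq: "(1 - x)\<^sup>2 * (\<Sum>j\<le>K. real (Suc j) * x ^ j)
      = 1 - x ^ Suc K * (real (K + 2) - real (K + 1) * x)"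
  proof (induction K)
    case (Suc K)
    have "(1 - x)\<^sup>2 * (\<Sum>j\<le>Suc K. real (Suc j) * x ^ j)
        = (1 - x)\<^sup>2 * (\<Sum>j\<le>K. real (Suc j) * x ^ j) + (1 - x)\<^sup>2 * (real (Suc (Suc K)) * x ^ Suc K)"
      by (simp add: distrib_left del: of_nat_Suc power_Suc)
    also have "\<dots> = 1 - x ^ Suc (Suc K) * (real (Suc K + 2) - real (Suc K + 1) * x)"
      unfolding Suc.IH by (simp add: algebra_simps power2_eq_square)
    finally show ?case .
  qed (simp add: power2_eq_square algebra_simps)
  have "real (K + 1) * x \<le> real (K + 1)" using assms by (intro mult_left_le) auto
  then have "0 \<le> real (K + 2) - real (K + 1) * x" by linarith
  then have "0 \<le> x ^ Suc K * (real (K + 2) - real (K + 1) * x)"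
    using assms by (intro mult_nonneg_nonneg) auto
  then have "(\<Sum>j\<le>K. real (Suc j) * x ^ j) * (1 - x)\<^sup>2 \<le> 1"
    using eq by (simp add: mult.commute)
  then show ?thesis using assms by (subst pos_le_divide_eq) auto
qed

text \<open>The sum over the box factors into univariate sums. The bound depends on \<open>A\<close>
  only through the sum of the \<open>x n\<close>, which is how the dimension drops out.\<close>

lemma sum_PiE_prod_le_exp:
  fixes g :: "nat \<Rightarrow> nat \<Rightarrow> real"
  assumes "\<And>n j. n \<in> A \<Longrightarrow> 0 \<le> g n j" "\<And>n. n \<in> A \<Longrightarrow> (\<Sum>j\<le>K. g n j) \<le> 1 + C * x n"
    and "finite A"
  shows "(\<Sum>\<alpha>\<in>Pi\<^sub>E A (\<lambda>_. {..K}). \<Prod>n\<in>A. g n (\<alpha> n)) \<le> exp (C * (\<Sum>n\<in>A. x n))"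
proof -
  have "(\<Sum>\<alpha>\<in>Pi\<^sub>E A (\<lambda>_. {..K}). \<Prod>n\<in>A. g n (\<alpha> n)) = (\<Prod>n\<in>A. \<Sum>j\<le>K. g n j)"
    using assms(3) by (simp add: prod_sum_PiE)
  also have "\<dots> \<le> (\<Prod>n\<in>A. exp (C * x n))"
  proof (intro prod_mono conjI)
    fix n assume n: "n \<in> A"
    show "0 \<le> (\<Sum>j\<le>K. g n j)" using assms(1)[OF n] by (intro sum_nonneg) auto
    show "(\<Sum>j\<le>K. g n j) \<le> exp (C * x n)"
      using assms(2)[OF n] exp_ge_add_one_self[of "C * x n"] by linarith
  qed
  also have "\<dots> = exp (C * (\<Sum>n\<in>A. x n))"
    using assms(3) by (simp add: exp_sum sum_distrib_left)
  finally show ?thesis .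
qed

locale sparse_grid_setting =
  fixes \<tau> \<kappa> w :: "nat \<Rightarrow> real" and N :: "nat \<Rightarrow> nat" and c r \<beta> :: real
  assumes isotone: "mono_on {1..} \<tau>"
    and growth: "r > 1" "c > 0" "\<And>n. n \<ge> 1 \<Longrightarrow> \<tau> n \<ge> c * real n powr r"
    and kappa: "\<And>n. n \<ge> 1 \<Longrightarrow> \<kappa> n = \<tau> n + sqrt (1 + (\<tau> n)\<^sup>2)"
    and weights: "\<And>n. n \<ge> 1 \<Longrightarrow> w n = ln (\<kappa> n)"
    and points: "\<And>j. N j = nat \<lceil>(1/2) * (real j + 2)\<rceil>"
    and beta: "1 < \<beta>" "\<beta> < r"
begin

section \<open>Elementary consequences of the choice of parameters\<close>

lemma tau_pos: "\<tau> n > 0" if "n \<ge> 1"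
proof -
  have "0 < c * real n powr r" using growth(2) that by simp
  also have "\<dots> \<le> \<tau> n" by (rule growth(3)[OF that])
  finally show ?thesis .
qed

lemma bernstein: "bernstein_ellipse (\<tau> n) (\<kappa> n)" if "n \<ge> 1"
  using tau_pos[OF that] kappa[OF that] by unfold_locales

lemma kappa_1: "\<kappa> 1 > 1"
  by (rule bernstein_ellipse.kappa_gt_1[OF bernstein]) simp

lemma kappa_ge: "\<kappa> 1 \<le> \<kappa> n" if "n \<ge> 1"
proof -
  have "\<tau> 1 \<le> \<tau> n" using isotone that by (auto simp: mono_on_def)
  moreover have "sqrt (1 + (\<tau> 1)\<^sup>2) \<le> sqrt (1 + (\<tau> n)\<^sup>2)"
    using calculation tau_pos[of 1] by (intro real_sqrt_le_mono add_left_mono power_mono) auto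
  ultimately show ?thesis using kappa[OF order_refl] kappa[OF that] by linarith
qed

lemma kappa_gt_1: "\<kappa> n > 1" if "n \<ge> 1"
  using kappa_1 kappa_ge[OF that] by linarith

lemma points_ge: "j + 2 \<le> 2 * N j"
proof -
  have "(1/2) * (real j + 2) \<le> of_int \<lceil>(1/2) * (real j + 2)\<rceil>" by (rule le_of_int_ceiling)
  also have "\<dots> = real (N j)" unfolding points by simp
  finally have "real (j + 2) \<le> real (2 * N j)" by simp
  then show ?thesis by (simp only: of_nat_le_iff)
qed

lemma points_le: "N j \<le> Suc j"
proof (cases "j = 0")
  case False
  then have "(1/2) * (real j + 2) \<le> of_int (int (Suc j))" by simp
  then have "\<lceil>(1/2) * (real j + 2)\<rceil> \<le> int (Suc j)" by (simp only: ceiling_le_iff)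
  then show ?thesis unfolding points by linarith
qed (simp add: points)

text \<open>What remains of \<open>1 / \<kappa> n\<close> after the factor
  \<open>\<kappa> n powr (- (1 - 1 / \<beta>))\<close> has been split off.\<close>

definition decay :: "nat \<Rightarrow> real" where
  "decay n = \<kappa> n powr (- 1 / \<beta>)"

lemma decay_pos: "0 < decay n" if "n \<ge> 1"
  using kappa_gt_1[OF that] by (simp add: decay_def)

lemma decay_1: "decay 1 < 1"
  using kappa_1 beta unfolding decay_def by (subst powr_less_one) (auto simp: divide_neg_pos)

lemma decay_le: "decay n \<le> decay 1" if "n \<ge> 1"
  using kappa_ge[OF that] kappa_1 beta unfolding decay_def by (intro powr_mono2') auto

lemma decay_less_1: "decay n < 1" if "n \<ge> 1"
  using decay_le[OF that] decay_1 by linarith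

text \<open>Since \<open>\<kappa> n \<ge> c * n powr r\<close>, the terms are dominated by a
  multiple of \<open>n powr (- r / \<beta>)\<close>, and \<open>r / \<beta> > 1\<close>.\<close>

lemma sum_decay_le: "\<exists>X. \<forall>m. (\<Sum>n=1..m. decay n) \<le> X"
proof -
  define y where "y = (\<lambda>n. c powr (- 1 / \<beta>) * real n powr (- r / \<beta>))"
  have "- r / \<beta> < -1" using beta by (simp add: field_simps)
  then have y: "summable y" unfolding y_def by (intro summable_mult) (simp add: summable_real_powr_iff)
  have xy: "decay n \<le> y n" if "n \<ge> 1" for n
  proof -
    have "c * real n powr r \<le> \<kappa> n"
    proof -
      have "0 \<le> sqrt (1 + (\<tau> n)\<^sup>2)" by simp
      then show ?thesis using growth(3)[OF that] kappa[OF that] by linarith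
    qed
    then have "decay n \<le> (c * real n powr r) powr (- 1 / \<beta>)"
      using growth that beta unfolding decay_def by (intro powr_mono2') auto
    also have "\<dots> = y n" using growth by (simp add: y_def powr_mult powr_powr)
    finally show ?thesis .
  qed
  have "(\<Sum>n=1..m. decay n) \<le> suminf y" for m
  proof -
    have "(\<Sum>n=1..m. decay n) \<le> (\<Sum>n=1..m. y n)" using xy by (intro sum_mono) auto
    also have "\<dots> \<le> suminf y" by (rule sum_le_suminf[OF y]) (auto simp: y_def)
    finally show ?thesis .
  qed
  then show ?thesis by blast
qed

text \<open>As \<open>w n = ln (\<kappa> n)\<close>, products of powers translate into the weighted
  sums that define \<open>X_set\<close>.\<close>

lemma prod_kappa_powr:
  "(\<Prod>n=1..m. (\<kappa> n powr a) ^ \<alpha> n) = exp (a * (\<Sum>n=1..m. real (\<alpha> n) * w n))"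
proof -
  have "(\<kappa> n powr a) ^ \<alpha> n = exp (a * (real (\<alpha> n) * w n))" if "n \<in> {1..m}" for n
    using kappa_gt_1[of n] weights[of n] that
    by (simp add: powr_def mult_ac flip: exp_of_nat_mult)
  then show ?thesis by (simp add: exp_sum sum_distrib_left)
qed

lemma w_ge: "w n \<ge> ln (\<kappa> 1)" if "n \<ge> 1"
  using kappa_ge[OF that] kappa_1 weights[OF that] by simp

lemma w_pos: "w n > 0" if "n \<ge> 1"
  using kappa_gt_1[OF that] weights[OF that] by simp

lemma X_set_subset_box:
  assumes "real q / ln (\<kappa> 1) \<le> real K"
  shows "X_set w q m \<subseteq> Pi\<^sub>E {1..m} (\<lambda>_. {..K})"
proof
  fix \<alpha> assume \<alpha>: "\<alpha> \<in> X_set w q m"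
  have "\<alpha> i \<le> K" if i: "i \<in> {1..m}" for i
  proof -
    have "real (\<alpha> i) * ln (\<kappa> 1) \<le> real (\<alpha> i) * w i"
      using i by (intro mult_left_mono w_ge) auto
    also have "\<dots> \<le> (\<Sum>n=1..m. real (\<alpha> n) * w n)"
      using i by (intro member_le_sum) (auto intro!: mult_nonneg_nonneg less_imp_le[OF w_pos])
    also have "\<dots> \<le> real q" using \<alpha> by (simp add: X_set_def)
    finally have "real (\<alpha> i) \<le> real q / ln (\<kappa> 1)"
      using kappa_1 by (subst pos_le_divide_eq) auto
    then show ?thesis using assms by linarith
  qed
  then show "\<alpha> \<in> Pi\<^sub>E {1..m} (\<lambda>_. {..K})" using \<alpha> by (auto simp: X_set_def)
qed

lemma box_exists: "\<exists>K. real q / ln (\<kappa> 1) \<le> real K"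
  using real_arch_simple by blast

lemma finite_X_set: "finite (X_set w q m)"
proof -
  obtain K where "real q / ln (\<kappa> 1) \<le> real K" using box_exists by blast
  from X_set_subset_box[OF this] show ?thesis by (rule finite_subset) (auto intro: finite_PiE)
qed

lemma Y_subset_X: "Y_set w q m \<subseteq> X_set w q m"
  by (auto simp: X_set_def Y_set_def)

lemma card_product_grid:
  fixes \<alpha> :: "nat \<Rightarrow> nat"
  shows "card (Pi\<^sub>E {1..m} (\<lambda>n. gauss_points (N (\<alpha> n)))) = (\<Prod>n=1..m. N (\<alpha> n))"
  by (simp add: card_PiE gauss_points_eq)

lemma finite_sparse_grid: "finite (sparse_grid w N q m)"
  unfolding sparse_grid_def
  by (intro finite_UN_I finite_subset[OF Y_subset_X finite_X_set] finite_PiE) auto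

text \<open>Rankin's trick: on \<open>X_set\<close> the factor \<open>exp (q / \<beta>)\<close>
  times the product of the \<open>decay n ^ \<alpha> n\<close> is at least 1. Inserting it allows
  the sum to be enlarged to a box, where it factors.\<close>

lemma cost_le: "\<exists>D\<ge>1. \<forall>m q. real (cost w N q m) \<le> D * exp (real q / \<beta>)"
proof -
  obtain X where X: "\<And>m. (\<Sum>n=1..m. decay n) \<le> X" using sum_decay_le by blast
  define C where "C = 2 / (1 - decay 1)\<^sup>2"
  have C: "C > 0" using decay_1 by (simp add: C_def)
  have factor: "(\<Sum>j\<le>K. real (Suc j) * decay n ^ j) \<le> 1 + C * decay n" if n: "n \<in> {1..m}" for n m K
  proof -
    have x: "0 < decay n" "decay n < 1" "decay n \<le> decay 1" using decay_pos decay_less_1 decay_le n by auto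
    have "(\<Sum>j\<le>K. real (Suc j) * decay n ^ j) \<le> 1 / (1 - decay n)\<^sup>2"
      using x by (intro sum_Suc_power_le) auto
    \<comment> \<open>Separating the 1 shows an excess linear in \<open>decay n\<close>, hence
      summable over \<open>n\<close>; \<open>decay n \<le> decay 1\<close> makes its coefficient
      uniform.\<close>
    also have "1 / (1 - decay n)\<^sup>2 = 1 + (2 - decay n) * decay n / (1 - decay n)\<^sup>2"
    proof -
      have "(2 - decay n) * decay n = 1 - (1 - decay n)\<^sup>2" by (simp add: power2_eq_square algebra_simps)
      then show ?thesis using x by (simp only: diff_divide_distrib) simp
    qed
    also have "(2 - decay n) * decay n / (1 - decay n)\<^sup>2 \<le> 2 * decay n / (1 - decay 1)\<^sup>2"
      using x decay_1 by (intro frac_le mult_right_mono power_mono) auto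
    finally show ?thesis by (simp add: C_def)
  qed
  have "real (cost w N q m) \<le> exp (C * X) * exp (real q / \<beta>)" for m q
  proof -
    obtain K where K: "real q / ln (\<kappa> 1) \<le> real K" using box_exists by blast
    have "cost w N q m \<le> (\<Sum>\<alpha>\<in>Y_set w q m. card (Pi\<^sub>E {1..m} (\<lambda>n. gauss_points (N (\<alpha> n)))))"
      unfolding cost_def sparse_grid_def
      by (rule card_UN_le) (rule finite_subset[OF Y_subset_X finite_X_set])
    also have "\<dots> \<le> (\<Sum>\<alpha>\<in>X_set w q m. \<Prod>n=1..m. N (\<alpha> n))"
      unfolding card_product_grid by (intro sum_mono2 finite_X_set Y_subset_X) auto
    also have "\<dots> \<le> (\<Sum>\<alpha>\<in>X_set w q m. \<Prod>n=1..m. Suc (\<alpha> n))"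
      by (intro sum_mono prod_mono conjI points_le) auto
    finally have "real (cost w N q m) \<le> real (\<Sum>\<alpha>\<in>X_set w q m. \<Prod>n=1..m. Suc (\<alpha> n))"
      by (simp only: of_nat_le_iff)
    also have "\<dots> = (\<Sum>\<alpha>\<in>X_set w q m. \<Prod>n=1..m. real (Suc (\<alpha> n)))"
      by (simp only: of_nat_sum of_nat_prod)
    also have "\<dots> \<le> (\<Sum>\<alpha>\<in>X_set w q m. exp (real q / \<beta>) * (\<Prod>n=1..m. real (Suc (\<alpha> n)) * decay n ^ \<alpha> n))"
    proof (rule sum_mono)
      fix \<alpha> assume "\<alpha> \<in> X_set w q m"
      then have "(\<Sum>n=1..m. real (\<alpha> n) * w n) \<le> real q" by (simp add: X_set_def)
      then have "(\<Sum>n=1..m. real (\<alpha> n) * w n) / \<beta> \<le> real q / \<beta>"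
        using beta by (intro divide_right_mono) auto
      then have "1 \<le> exp (real q / \<beta>) * exp (- 1 / \<beta> * (\<Sum>n=1..m. real (\<alpha> n) * w n))"
        by (simp flip: exp_add)
      also have "exp (- 1 / \<beta> * (\<Sum>n=1..m. real (\<alpha> n) * w n)) = (\<Prod>n=1..m. decay n ^ \<alpha> n)"
        unfolding decay_def by (rule prod_kappa_powr[symmetric])
      finally have "(\<Prod>n=1..m. real (Suc (\<alpha> n))) * 1
          \<le> (\<Prod>n=1..m. real (Suc (\<alpha> n))) * (exp (real q / \<beta>) * (\<Prod>n=1..m. decay n ^ \<alpha> n))"
        by (intro mult_left_mono prod_nonneg) auto
      then show "(\<Prod>n=1..m. real (Suc (\<alpha> n)))
          \<le> exp (real q / \<beta>) * (\<Prod>n=1..m. real (Suc (\<alpha> n)) * decay n ^ \<alpha> n)"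
        unfolding prod.distrib by (simp only: mult_ac mult_1_left)
    qed
    also have "\<dots> = exp (real q / \<beta>) * (\<Sum>\<alpha>\<in>X_set w q m. \<Prod>n=1..m. real (Suc (\<alpha> n)) * decay n ^ \<alpha> n)"
      by (simp only: sum_distrib_left)
    also have "(\<Sum>\<alpha>\<in>X_set w q m. \<Prod>n=1..m. real (Suc (\<alpha> n)) * decay n ^ \<alpha> n)
        \<le> (\<Sum>\<alpha>\<in>Pi\<^sub>E {1..m} (\<lambda>_. {..K}). \<Prod>n=1..m. real (Suc (\<alpha> n)) * decay n ^ \<alpha> n)"
      using decay_pos by (intro sum_mono2 X_set_subset_box[OF K] finite_PiE prod_nonneg mult_nonneg_nonneg)
        (auto intro!: zero_le_power less_imp_le)
    also have "\<dots> \<le> exp (C * (\<Sum>n=1..m. decay n))"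
    proof (rule sum_PiE_prod_le_exp)
      show "0 \<le> real (Suc j) * decay n ^ j" if "n \<in> {1..m}" for n j
        using decay_pos[of n] that by simp
    qed (use factor in auto)
    also have "\<dots> \<le> exp (C * X)"
      using X[of m] C by simp
    finally show ?thesis by (simp add: mult.commute)
  qed
  moreover have "1 \<le> exp (C * X)"
    using C X[of 0] by simp
  ultimately show ?thesis by blast
qed

text \<open>
  \<open>Y_set\<close> contains the multi-index \<open>(k, 0, \<dots>, 0)\<close> with \<open>k = \<lfloor>q / w 1\<rfloor>\<close>. A grid without points would
  make the right-hand side of the error bound vanish, since \<open>0 powr a = 0\<close>.
\<close>

lemma cost_pos:
  assumes "m \<ge> 1"
  shows "cost w N q m \<ge> 1"
proof -
  define k where "k = nat \<lfloor>real q / w 1\<rfloor>"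
  define \<alpha> where "\<alpha> = (\<lambda>n\<in>{1..m}. if n = 1 then k else 0)"
  have w: "w 1 > 0" by (rule w_pos) simp
  have k: "real k \<le> real q / w 1" "real q / w 1 < real k + 1"
    using w by (auto simp: k_def)
  have "(\<Sum>n=1..m. real (\<alpha> n) * w n) = (\<Sum>n\<in>{1}. real (\<alpha> n) * w n)"
    using assms by (intro sum.mono_neutral_right) (auto simp: \<alpha>_def)
  then have sum: "(\<Sum>n=1..m. real (\<alpha> n) * w n) = real k * w 1"
    using assms by (simp add: \<alpha>_def)
  have "w 1 \<le> (\<Sum>n=1..m. w n)"
    using assms by (intro member_le_sum) (auto intro: less_imp_le[OF w_pos])
  moreover have "real k * w 1 \<le> real q" "real q < real k * w 1 + w 1"
    using k w by (auto simp: field_simps)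
  ultimately have "\<alpha> \<in> Y_set w q m"
    unfolding Y_set_def mem_Collect_eq sum by (auto simp: \<alpha>_def)
  then have sub: "Pi\<^sub>E {1..m} (\<lambda>n. gauss_points (N (\<alpha> n))) \<subseteq> sparse_grid w N q m"
    by (auto simp: sparse_grid_def)
  have "1 \<le> (\<Prod>n=1..m. N (\<alpha> n))"
    using points_ge by (intro prod_ge_1) (metis add_leE le_0_eq mult_is_0 not_less_eq_eq One_nat_def numeral_2_eq_2 old.nat.distinct(2))
  also have "\<dots> \<le> cost w N q m"
    unfolding cost_def card_product_grid[symmetric] by (rule card_mono[OF finite_sparse_grid sub])
  finally show ?thesis .
qed

text \<open>Level 0 gets the exact bound 1 and not the general expression, whose constant exceeds 1
  and would be raised to the number of variables at level 0.\<close>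

definition diff_bound :: "nat \<Rightarrow> nat \<Rightarrow> real" where
  "diff_bound n j = (if j = 0 then 1 else 2 * (4 / (1 - 1 / \<kappa> n) ^ 3) * (1 / \<kappa> n) ^ j)"

lemma diff_bound_nonneg: "diff_bound n j \<ge> 0" if "n \<ge> 1"
  using kappa_gt_1[OF that] by (simp add: diff_bound_def)

text \<open>Rankin's trick in the opposite direction: outside \<open>X_set\<close> the product of
  the \<open>(\<kappa> n powr a) ^ \<alpha> n\<close> times \<open>exp (- a q)\<close> is at least
  1. Multiplied into the bounds it leaves \<open>decay n ^ j\<close> in place of
  \<open>(1 / \<kappa> n) ^ j\<close>.\<close>

lemma sum_diff_bound_le:
  "\<exists>P>0. \<forall>m q K. (\<Sum>\<alpha>\<in>Pi\<^sub>E {1..m} (\<lambda>_. {..K}) - X_set w q m. \<Prod>n=1..m. diff_bound n (\<alpha> n))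
     \<le> P * exp (- (1 - 1 / \<beta>) * real q)"
proof -
  obtain X where X: "\<And>m. (\<Sum>n=1..m. decay n) \<le> X" using sum_decay_le by blast
  define a where "a = 1 - 1 / \<beta>"
  define A where "A = 2 * (4 / (1 - 1 / \<kappa> 1) ^ 3)"
  define C where "C = A / (1 - decay 1)"
  define g where "g = (\<lambda>n j. diff_bound n j * (\<kappa> n powr a) ^ j)"
  have a: "a > 0" using beta by (simp add: a_def)
  have A: "A > 0" using kappa_1 by (simp add: A_def)
  have C: "C > 0" using A decay_1 by (simp add: C_def)
  have g_nonneg: "g n j \<ge> 0" if "n \<in> {1..m}" for n j m
    using diff_bound_nonneg[of n j] that by (simp add: g_def)
  \<comment> \<open>One factor \<open>decay n\<close> is kept apart, so that the positive levels sum
    to a multiple of it. \<open>A\<close> is the univariate constant at \<open>\<kappa> 1\<close>,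
    the largest one.\<close>
  have g_Suc: "g n (Suc j) \<le> A * decay n * decay n ^ j" if n: "n \<in> {1..m}" for n j m
  proof -
    have k: "\<kappa> n > 1" "\<kappa> 1 \<le> \<kappa> n" using kappa_gt_1 kappa_ge n by auto
    have "1 / \<kappa> n * \<kappa> n powr a = \<kappa> n powr (a - 1)"
      using k by (simp add: powr_diff)
    also have "a - 1 = - 1 / \<beta>" by (simp add: a_def)
    finally have x: "1 / \<kappa> n * \<kappa> n powr a = decay n" by (simp add: decay_def)
    have "g n (Suc j) = 2 * (4 / (1 - 1 / \<kappa> n) ^ 3) * (1 / \<kappa> n * \<kappa> n powr a) ^ Suc j"
      unfolding g_def diff_bound_def power_mult_distrib by simp
    also have "\<dots> \<le> A * decay n ^ Suc j"
    proof -
      have "1 / \<kappa> n \<le> 1 / \<kappa> 1" "1 / \<kappa> 1 < 1" "1 / \<kappa> n < 1"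
        using k kappa_1 by (auto intro: divide_left_mono)
      then have "(1 - 1 / \<kappa> 1) ^ 3 \<le> (1 - 1 / \<kappa> n) ^ 3" "0 < (1 - 1 / \<kappa> 1) ^ 3"
          "0 < (1 - 1 / \<kappa> n) ^ 3"
        by (auto intro!: power_mono simp del: zero_less_power_eq)
      then have "2 * (4 / (1 - 1 / \<kappa> n) ^ 3) \<le> A"
        unfolding A_def by (intro mult_left_mono divide_left_mono mult_pos_pos) auto
      then show ?thesis unfolding x using decay_pos[of n] n by (intro mult_right_mono) auto
    qed
    finally show ?thesis by (simp add: mult_ac)
  qed
  have factor: "(\<Sum>j\<le>K. g n j) \<le> 1 + C * decay n" if n: "n \<in> {1..m}" for n m K
  proof -
    have x: "0 < decay n" "decay n < 1" "decay n \<le> decay 1" using decay_pos decay_less_1 decay_le n by auto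
    have "(\<Sum>j\<le>K. g n j) = g n 0 + (\<Sum>j<K. g n (Suc j))"
      by (simp add: sum.atMost_shift)
    also have "\<dots> \<le> 1 + (\<Sum>j<K. A * decay n * decay n ^ j)"
      using g_Suc[OF n] by (intro add_mono sum_mono) (auto simp: g_def diff_bound_def)
    also have "\<dots> = 1 + A * decay n * (\<Sum>j<K. decay n ^ j)" by (simp add: sum_distrib_left)
    also have "\<dots> \<le> 1 + A * decay n * (1 / (1 - decay 1))"
    proof -
      have "(\<Sum>j<K. decay n ^ j) \<le> 1 / (1 - decay n)" using x by (intro sum_power_le) auto
      also have "\<dots> \<le> 1 / (1 - decay 1)" using x decay_1 by (intro divide_left_mono) auto
      finally show ?thesis using A x by (intro add_left_mono mult_left_mono) auto
    qed
    finally show ?thesis by (simp add: C_def mult_ac)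
  qed
  have "(\<Sum>\<alpha>\<in>Pi\<^sub>E {1..m} (\<lambda>_. {..K}) - X_set w q m. \<Prod>n=1..m. diff_bound n (\<alpha> n))
      \<le> exp (C * X) * exp (- a * real q)" for m q K
  proof -
    let ?B = "Pi\<^sub>E {1..m} (\<lambda>_. {..K::nat})"
    have fin: "finite ?B" by (intro finite_PiE) auto
    have "(\<Sum>\<alpha>\<in>?B - X_set w q m. \<Prod>n=1..m. diff_bound n (\<alpha> n))
        \<le> (\<Sum>\<alpha>\<in>?B - X_set w q m. exp (- a * real q) * (\<Prod>n=1..m. g n (\<alpha> n)))"
    proof (rule sum_mono)
      fix \<alpha> assume "\<alpha> \<in> ?B - X_set w q m"
      then have "real q < (\<Sum>n=1..m. real (\<alpha> n) * w n)"
        by (auto simp: X_set_def PiE_iff)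
      then have "1 \<le> exp (- a * real q) * exp (a * (\<Sum>n=1..m. real (\<alpha> n) * w n))"
        using a by (simp flip: exp_add)
      also have "exp (a * (\<Sum>n=1..m. real (\<alpha> n) * w n)) = (\<Prod>n=1..m. (\<kappa> n powr a) ^ \<alpha> n)"
        by (rule prod_kappa_powr[symmetric])
      finally have "(\<Prod>n=1..m. diff_bound n (\<alpha> n)) * 1
          \<le> (\<Prod>n=1..m. diff_bound n (\<alpha> n)) * (exp (- a * real q) * (\<Prod>n=1..m. (\<kappa> n powr a) ^ \<alpha> n))"
        using diff_bound_nonneg by (intro mult_left_mono prod_nonneg) auto
      then show "(\<Prod>n=1..m. diff_bound n (\<alpha> n)) \<le> exp (- a * real q) * (\<Prod>n=1..m. g n (\<alpha> n))"
        unfolding g_def prod.distrib by (simp only: mult_ac mult_1_left)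
    qed
    also have "\<dots> = exp (- a * real q) * (\<Sum>\<alpha>\<in>?B - X_set w q m. \<Prod>n=1..m. g n (\<alpha> n))"
      by (simp only: sum_distrib_left)
    also have "(\<Sum>\<alpha>\<in>?B - X_set w q m. \<Prod>n=1..m. g n (\<alpha> n)) \<le> (\<Sum>\<alpha>\<in>?B. \<Prod>n=1..m. g n (\<alpha> n))"
      using g_nonneg by (intro sum_mono2 fin prod_nonneg) auto
    also have "\<dots> \<le> exp (C * (\<Sum>n=1..m. decay n))"
      using g_nonneg factor by (intro sum_PiE_prod_le_exp) auto
    also have "\<dots> \<le> exp (C * X)"
      using X[of m] C by simp
    finally show ?thesis by (simp add: mult.commute)
  qed
  then show ?thesis unfolding a_def by (intro exI[of _ "exp (C * X)"]) auto
qed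

lemma op_bound_quad_diff_level:
  assumes "n \<ge> 1"
  shows "op_bound (\<Sigma>_nbhd (\<tau> n)) (quad_diff N j) (diff_bound n j)"
proof (cases "j = 0")
  case True
  have "N 0 > 0" using points_ge[of 0] by simp
  moreover have "quad_diff N 0 = gauss_quad (N 0)" by (simp add: quad_diff_def fun_eq_iff)
  moreover have "complex_of_real ` \<Gamma> \<subseteq> \<Sigma>_nbhd (\<tau> n)"
    using of_real_in_Sigma_nbhd tau_pos[OF assms] by (auto simp: less_imp_le)
  ultimately show ?thesis using True op_bound_gauss_quad by (simp add: diff_bound_def)
next
  case False
  then show ?thesis
    using bernstein_ellipse.op_bound_quad_diff[OF bernstein[OF assms], of N j] points_ge
    by (simp add: diff_bound_def)
qed

text \<open>\<open>P\<close> is a hypothesis because it must be fixed before \<open>f\<close>,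
  \<open>m\<close> and \<open>q\<close>.\<close>

lemma sparse_quad_error:
  fixes m q :: nat
  assumes ext: "analytic_extension \<tau> f F" and \<psi>: "\<psi> \<in> {1..} \<rightarrow>\<^sub>E \<Gamma>"
    and P: "\<And>m q K. (\<Sum>\<alpha>\<in>Pi\<^sub>E {1..m} (\<lambda>_. {..K}) - X_set w q m. \<Prod>n=1..m. diff_bound n (\<alpha> n))
     \<le> P * exp (- (1 - 1 / \<beta>) * real q)"
  defines "G \<equiv> anchored (\<lambda>n. complex_of_real (\<psi> n)) m F" and "g \<equiv> anchored \<psi> m f"
  shows "\<bar>integral_op m g - sparse_quad w N q m g\<bar>
    \<le> P * exp (- (1 - 1 / \<beta>) * real q) * \<Sigma>_norm \<tau> m G" and "0 \<le> \<Sigma>_norm \<tau> m G"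
proof -
  interpret anchored_extension \<tau> f F \<psi> m
    using ext \<psi> tau_pos by unfold_locales
  define M where "M = \<Sigma>_norm \<tau> m G"
  have sep: "sep_analytic_ext m S G g"
    unfolding G_def g_def by (rule sep_analytic_ext_anchored)
  have M: "cmod (G z) \<le> M" if "z \<in> Pi\<^sub>E {1..m} S" for z
    using norm_le_Sigma_norm[OF that] by (simp add: G_def M_def)
  have Gam: "complex_of_real ` \<Gamma> \<subseteq> S n" if "n \<in> {1..m}" for n
    using of_real_in_Sigma_nbhd tau[of n] that by (auto simp: less_imp_le)
  have "(\<lambda>n\<in>{1..m}. complex_of_real 0) \<in> Pi\<^sub>E {1..m} S"
    unfolding restrict_PiE_iff using of_real_in_Sigma_nbhd[of 0] tau by (auto simp: less_imp_le)
  from M[OF this] have M0: "0 \<le> M" using norm_ge_zero order.trans by blast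
  then show "0 \<le> \<Sigma>_norm \<tau> m G" by (simp add: M_def)
  \<comment> \<open>The error of the full tensor rule. It may depend on \<open>m\<close>, because
    \<open>K\<close> tends to infinity with \<open>m\<close> fixed while the other term is uniform
    in \<open>K\<close>.\<close>
  define E where "E = (\<lambda>K. (\<Sum>n=1..m. 2 * (4 / (1 - 1 / \<kappa> n) ^ 3) * (1 / \<kappa> n) ^ K) * M)"
  let ?T = "\<lambda>\<alpha>. tensor_op (\<lambda>n. quad_diff N (\<alpha> n)) m g"
  have bound: "\<bar>integral_op m g - sparse_quad w N q m g\<bar> \<le> E K + P * exp (- (1 - 1 / \<beta>) * real q) * M"
    if K: "real q / ln (\<kappa> 1) \<le> real K" for K
  proof -
    let ?B = "Pi\<^sub>E {1..m} (\<lambda>_. {..K})"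
    have N: "0 < N K" "K < 2 * N K" using points_ge[of K] by auto
    have box: "tensor_op (\<lambda>_. gauss_quad (N K)) m g = (\<Sum>\<alpha>\<in>?B. ?T \<alpha>)"
      using tensor_op_box[of "quad_diff N" K m g] node_op_quad_diff node_op_gauss_quad
      by (simp add: sum_quad_diff)
    have "\<bar>integral_op m g - tensor_op (\<lambda>_. gauss_quad (N K)) m g\<bar> \<le> E K"
      unfolding E_def
    proof (rule integral_tensor_error[OF node_op_gauss_quad _ Gam _ sep M])
      show "op_bound (S n) (gauss_quad (N K)) 1" if "n \<in> {1..m}" for n
        by (rule op_bound_gauss_quad[OF N(1) Gam[OF that]])
      show "\<bar>(LINT t | \<Gamma>_measure. v t) - gauss_quad (N K) v\<bar>
          \<le> 2 * (4 / (1 - 1 / \<kappa> n) ^ 3) * (1 / \<kappa> n) ^ K * M"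
        if "n \<in> {1..m}" "V analytic_on S n" "\<And>z. z \<in> S n \<Longrightarrow> cmod (V z) \<le> M"
          "\<And>t. t \<in> \<Gamma> \<Longrightarrow> V (of_real t) = of_real (v t)" for n V v M
        using bernstein_ellipse.gauss_quad_error[OF bernstein N(2) that(2-4)] that(1) by simp
    qed
    moreover have "(\<Sum>\<alpha>\<in>?B. ?T \<alpha>) - sparse_quad w N q m g = (\<Sum>\<alpha>\<in>?B - X_set w q m. ?T \<alpha>)"
      unfolding sparse_quad_def
      by (rule sum_diff[symmetric, OF _ X_set_subset_box[OF K]]) (auto intro: finite_PiE)
    moreover have "\<bar>\<Sum>\<alpha>\<in>?B - X_set w q m. ?T \<alpha>\<bar> \<le> P * exp (- (1 - 1 / \<beta>) * real q) * M"
    proof -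
      have "\<bar>\<Sum>\<alpha>\<in>?B - X_set w q m. ?T \<alpha>\<bar> \<le> (\<Sum>\<alpha>\<in>?B - X_set w q m. (\<Prod>n=1..m. diff_bound n (\<alpha> n)) * M)"
        by (intro order.trans[OF sum_abs] sum_mono tensor_op_bound[OF _ _ Gam sep M])
           (auto intro!: node_op_quad_diff op_bound_quad_diff_level)
      also have "\<dots> \<le> P * exp (- (1 - 1 / \<beta>) * real q) * M"
        unfolding sum_distrib_right[symmetric] by (intro mult_right_mono P M0)
      finally show ?thesis .
    qed
    ultimately show ?thesis unfolding box by linarith
  qed
  have "(\<lambda>K. (1 / \<kappa> n) ^ K) \<longlonglongrightarrow> 0" if "n \<in> {1..m}" for n
    using kappa_gt_1[of n] that by (intro LIMSEQ_realpow_zero) auto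
  then have "E \<longlonglongrightarrow> (\<Sum>n=1..m. 2 * (4 / (1 - 1 / \<kappa> n) ^ 3) * 0) * M"
    unfolding E_def by (intro tendsto_mult tendsto_sum tendsto_const)
  then have "(\<lambda>K. E K + P * exp (- (1 - 1 / \<beta>) * real q) * M)
      \<longlonglongrightarrow> 0 + P * exp (- (1 - 1 / \<beta>) * real q) * M"
    by (intro tendsto_intros) simp
  moreover obtain K0 where "real q / ln (\<kappa> 1) \<le> real K0" using box_exists by blast
  then have "\<forall>K\<ge>K0. \<bar>integral_op m g - sparse_quad w N q m g\<bar> \<le> E K + P * exp (- (1 - 1 / \<beta>) * real q) * M"
    by (intro allI impI bound) linarith
  ultimately show "\<bar>integral_op m g - sparse_quad w N q m g\<bar>
      \<le> P * exp (- (1 - 1 / \<beta>) * real q) * \<Sigma>_norm \<tau> m G"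
    using LIMSEQ_le_const unfolding M_def by fastforce
qed

text \<open>The cost bound solved for \<open>q\<close>. A negative power reverses the inequality
  only for a positive base, which is where \<open>cost_pos\<close> enters.\<close>

lemma exp_le_cost:
  assumes D: "D \<ge> 1" "real (cost w N q m) \<le> D * exp (real q / \<beta>)" and m: "m \<ge> 1"
  shows "exp (- (1 - 1 / \<beta>) * real q)
    \<le> D powr ((\<beta> - 1) / 2) * real (cost w N q m) powr (- (\<beta> - 1) / 2)"
proof -
  define e where "e = (\<beta> - 1) / 2"
  have e: "e > 0" using beta by (simp add: e_def)
  \<comment> \<open>The error decays like \<open>exp (q / \<beta>)\<close> to the power
    \<open>- 2 * e\<close>; half of this rate is given up to reach the exponent \<open>- e\<close>
    of the claim.\<close>
  have "(1 - 1 / \<beta>) = 2 * e / \<beta>" using beta by (simp add: e_def field_simps)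
  then have "- (1 - 1 / \<beta>) * real q \<le> - e * (real q / \<beta>)"
    using beta e by (simp add: divide_right_mono mult_right_mono)
  then have "exp (- (1 - 1 / \<beta>) * real q) \<le> exp (- e * (real q / \<beta>))" by simp
  also have "\<dots> = D powr e * (D * exp (real q / \<beta>)) powr (- e)"
  proof -
    have "(D * exp (real q / \<beta>)) powr (- e) = D powr (- e) * exp (real q / \<beta>) powr (- e)"
      by (rule powr_mult)
    moreover have "exp (real q / \<beta>) powr (- e) = exp (- e * (real q / \<beta>))"
      by (simp add: powr_def)
    moreover have "D powr e * D powr (- e) = 1"
      using D(1) by (simp flip: powr_add)
    ultimately show ?thesis by (metis mult.assoc mult_1_left)
  qed
  also have "\<dots> \<le> D powr e * real (cost w N q m) powr (- e)"
    using D cost_pos[OF m, of q] e by (intro mult_left_mono powr_mono2') auto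
  finally show ?thesis by (simp add: e_def minus_divide_left)
qed

end

theorem theorem5p7:
  fixes \<tau> \<kappa> w :: "nat \<Rightarrow> real" and N :: "nat \<Rightarrow> nat" and c r \<beta> :: real
  assumes isotone: "mono_on {1..} \<tau>"
    and unbounded: "filterlim \<tau> at_top sequentially"
    and growth: "r > 1" "c > 0" "\<And>n. n \<ge> 1 \<Longrightarrow> \<tau> n \<ge> c * real n powr r"
    and kappa: "\<And>n. n \<ge> 1 \<Longrightarrow> \<kappa> n = \<tau> n + sqrt (1 + (\<tau> n)\<^sup>2)"
    and weights: "\<And>n. n \<ge> 1 \<Longrightarrow> w n = ln (\<kappa> n)"
    and points: "\<And>j. N j = nat \<lceil>(1/2) * (real j + 2)\<rceil>"
    and beta: "1 < \<beta>" "\<beta> < r"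
  shows "\<exists>C>0. \<forall>f F \<psi> m q.
    integrable (completion (Pi\<^sub>M {1..} (\<lambda>_. \<Gamma>_measure))) f \<and>
    analytic_extension \<tau> f F \<and> \<psi> \<in> {1..} \<rightarrow>\<^sub>E \<Gamma> \<and> m \<ge> 1 \<longrightarrow>
      \<bar>integral_op m (anchored \<psi> m f) - sparse_quad w N q m (anchored \<psi> m f)\<bar>
        \<le> C * real (cost w N q m) powr (- (\<beta> - 1) / 2)
            * \<Sigma>_norm \<tau> m (anchored (\<lambda>n. complex_of_real (\<psi> n)) m F)"
proof -
  interpret sparse_grid_setting \<tau> \<kappa> w N c r \<beta>
    using assms by unfold_locales
  obtain P where P: "P > 0" "\<And>m q K. (\<Sum>\<alpha>\<in>Pi\<^sub>E {1..m} (\<lambda>_. {..K}) - X_set w q m. \<Prod>n=1..m. diff_bound n (\<alpha> n))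
     \<le> P * exp (- (1 - 1 / \<beta>) * real q)"
    using sum_diff_bound_le by blast
  obtain D where D: "D \<ge> 1" "\<And>m q. real (cost w N q m) \<le> D * exp (real q / \<beta>)"
    using cost_le by blast
  \<comment> \<open>Both \<open>P\<close> and \<open>D\<close> were obtained before
    \<open>f\<close>, \<open>m\<close> and \<open>q\<close> are introduced.\<close>
  define C where "C = P * D powr ((\<beta> - 1) / 2)"
  show ?thesis
  proof (intro exI[of _ C] conjI allI impI, goal_cases)
    case 1
    then show ?case using P D by (simp add: C_def)
  next
    case (2 f F \<psi> m q)
    let ?M = "\<Sigma>_norm \<tau> m (anchored (\<lambda>n. complex_of_real (\<psi> n)) m F)"
    have "\<bar>integral_op m (anchored \<psi> m f) - sparse_quad w N q m (anchored \<psi> m f)\<bar>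
        \<le> P * exp (- (1 - 1 / \<beta>) * real q) * ?M"
      using 2 by (intro sparse_quad_error P) auto
    also have "\<dots> \<le> P * (D powr ((\<beta> - 1) / 2) * real (cost w N q m) powr (- (\<beta> - 1) / 2)) * ?M"
      using 2 P(1) sparse_quad_error(2)[OF _ _ P(2)]
      by (intro mult_right_mono mult_left_mono exp_le_cost D) auto
    finally show ?case by (simp add: C_def mult_ac)
  qed
qed

end
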